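(* Let $(S,\Sigma,\nu)$ be a $\sigma$-finite measure space, let $X$ be an infinite dimensional separable Banach space and let $\mathcal{A}$ be the algebra $L_0^{wo}(\nu;\mathcal{L}(X))$ or $L_0^{wo}(\nu;\mathcal{K}(X))$. If $\delta:\mathcal{A}\to\mathcal{A}$ is a derivation, then there exists $w\in L_0^{wo}(\nu;\mathcal{L}(X))$ such that $\delta(f)=wf-fw$ for all $f\in\mathcal{A}$.
   Context: Banach spaces are complex; measure spaces are assumed complete. $\mathcal{L}(X)$ is the algebra of bounded linear operators on $X$ and $\mathcal{K}(X)$ the algebra of compact operators on $X$. For $X$ separable, $f:S\to\mathcal{L}(X)$ is weak operator $\nu$-measurable if $s\mapsto\langle f(s)x,x^*\rangle$ is $\nu$-measurable for all $x\in X$, $x^*\in X^*$. For a closed subspace $\mathfrak{B}\subseteq\mathcal{L}(X)$, $L_0^{wo}(\nu;\mathfrak{B})$ is the space of $\nu$-a.e. equivalence classes of weak operator $\nu$-measurable functions $S\to\mathfrak{B}$. With pointwise multiplication, $L_0^{wo}(\nu;\mathcal{L}(X))$ is a unital algebra and $L_0^{wo}(\nu;\mathcal{K}(X))$ a subalgebra. A derivation on an algebra $A$ is a linear map $\delta:A\to A$ with $\delta(xy)=\delta(x)y+x\delta(y)$ for all $x,y\in A$. *)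

theory Defs
  imports "HOL-Analysis.Analysis" "HOL-Algebra.Module"
begin

text \<open>Complex Banach spaces: a real Banach space (with its topology and norm) whose scalar
  multiplication extends to the complex numbers.\<close>

class complex_banach = banach +
  fixes scaleC :: "complex \<Rightarrow> 'a \<Rightarrow> 'a"  (infixr "*\<^sub>C" 75)
  assumes scaleC_add_right: "c *\<^sub>C (x + y) = c *\<^sub>C x + c *\<^sub>C y"
    and scaleC_add_left: "(c + d) *\<^sub>C x = c *\<^sub>C x + d *\<^sub>C x"
    and scaleC_scaleC: "c *\<^sub>C d *\<^sub>C x = (c * d) *\<^sub>C x"
    and scaleC_of_real: "of_real r *\<^sub>C x = r *\<^sub>R x"
    and norm_scaleC: "norm (c *\<^sub>C x) = cmod c * norm x"

instantiation complex :: complex_banach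
begin

definition scaleC_complex :: "complex \<Rightarrow> complex \<Rightarrow> complex" where
  "scaleC_complex c z = c * z"

instance
  by standard (simp_all add: scaleC_complex_def algebra_simps norm_mult scaleR_conv_of_real)

end

lemma scaleC_one: "1 *\<^sub>C (x :: 'a :: complex_banach) = x"
  using scaleC_of_real[of 1 x] by simp

lemma vector_space_scaleC: "vector_space (scaleC :: complex \<Rightarrow> 'a :: complex_banach \<Rightarrow> 'a)"
  by standard (simp_all add: scaleC_add_right scaleC_add_left scaleC_scaleC scaleC_one)

definition infinite_dim :: "'a :: complex_banach itself \<Rightarrow> bool" where
  "infinite_dim _ \<longleftrightarrow> \<not> (\<exists>B :: 'a set. finite B \<and> module.span scaleC B = UNIV)"

text \<open>The library type of bounded operators consists of the real-linear ones; the complex-linear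
  operators are singled out as a subset. With values in \<^typ>\<open>complex\<close> this is the dual space,
  on \<^typ>\<open>'a \<Rightarrow>\<^sub>L 'a\<close> it is the algebra of bounded operators on the space.\<close>

definition bounded_ops :: "('a :: complex_banach \<Rightarrow>\<^sub>L 'b :: complex_banach) set" where
  "bounded_ops = {T. \<forall>c x. blinfun_apply T (c *\<^sub>C x) = c *\<^sub>C blinfun_apply T x}"

definition compact_ops :: "('a :: complex_banach \<Rightarrow>\<^sub>L 'b :: complex_banach) set" where
  "compact_ops = {T \<in> bounded_ops. compact (closure (blinfun_apply T ` cball 0 1))}"

lift_definition blinfun_scaleC ::
  "complex \<Rightarrow> ('a :: complex_banach \<Rightarrow>\<^sub>L 'b :: complex_banach) \<Rightarrow> 'a \<Rightarrow>\<^sub>L 'b"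
  is "\<lambda>c T x. c *\<^sub>C T x"
proof -
  fix c :: complex and T :: "'a \<Rightarrow> 'b"
  have "bounded_linear (\<lambda>y :: 'b. c *\<^sub>C y)"
  proof (rule bounded_linear_intro[where K = "cmod c"])
    show "c *\<^sub>C r *\<^sub>R y = r *\<^sub>R c *\<^sub>C y" for r and y :: 'b
      by (metis scaleC_of_real scaleC_scaleC mult.commute)
  qed (simp_all add: scaleC_add_right norm_scaleC mult.commute)
  then show "bounded_linear T \<Longrightarrow> bounded_linear (\<lambda>x. c *\<^sub>C T x)"
    by (rule bounded_linear_compose)
qed

definition wo_measurable ::
    "'s measure \<Rightarrow> ('a :: complex_banach \<Rightarrow>\<^sub>L 'a) set \<Rightarrow> ('s \<Rightarrow> 'a \<Rightarrow>\<^sub>L 'a) set" where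
  "wo_measurable M B = {f \<in> space M \<rightarrow> B.
     \<forall>x. \<forall>\<phi> \<in> (bounded_ops :: ('a \<Rightarrow>\<^sub>L complex) set). (\<lambda>s. \<phi> (f s x)) \<in> borel_measurable M}"

definition ae_class ::
    "'s measure \<Rightarrow> ('s \<Rightarrow> 'a :: complex_banach \<Rightarrow>\<^sub>L 'a) \<Rightarrow> ('s \<Rightarrow> 'a \<Rightarrow>\<^sub>L 'a) set" where
  "ae_class M f = {g \<in> wo_measurable M bounded_ops. AE s in M. g s = f s}"

text \<open>Equivalence classes are always taken among all operator-valued functions, so that
  \<open>L0_wo M B\<close> consists of the classes with a \<open>B\<close>-valued representative and is literally a subset of
  \<open>L0_wo M bounded_ops\<close>, with the same operations. The unit is the class of the identity operator;
  it lies in the carrier only if that class has a \<open>B\<close>-valued representative.\<close>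

definition L0_wo ::
    "'s measure \<Rightarrow> ('a :: complex_banach \<Rightarrow>\<^sub>L 'a) set
       \<Rightarrow> (complex, ('s \<Rightarrow> 'a \<Rightarrow>\<^sub>L 'a) set) module" where
  "L0_wo M B =
     \<lparr>carrier = ae_class M ` wo_measurable M B,
      monoid.mult = (\<lambda>F G. \<Union>f\<in>F. \<Union>g\<in>G. ae_class M (\<lambda>s. f s o\<^sub>L g s)),
      one = ae_class M (\<lambda>s. id_blinfun),
      zero = ae_class M (\<lambda>s. 0),
      add = (\<lambda>F G. \<Union>f\<in>F. \<Union>g\<in>G. ae_class M (\<lambda>s. f s + g s)),
      smult = (\<lambda>c F. \<Union>f\<in>F. ae_class M (\<lambda>s. blinfun_scaleC c (f s)))\<rparr>"

definition derivation :: "(complex, 'b, 'm) module_scheme \<Rightarrow> ('b \<Rightarrow> 'b) \<Rightarrow> bool" where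
  "derivation A \<delta> \<longleftrightarrow>
     \<delta> \<in> carrier A \<rightarrow> carrier A \<and>
     (\<forall>x\<in>carrier A. \<forall>y\<in>carrier A. \<delta> (x \<oplus>\<^bsub>A\<^esub> y) = \<delta> x \<oplus>\<^bsub>A\<^esub> \<delta> y) \<and>
     (\<forall>c. \<forall>x\<in>carrier A. \<delta> (c \<odot>\<^bsub>A\<^esub> x) = c \<odot>\<^bsub>A\<^esub> \<delta> x) \<and>
     (\<forall>x\<in>carrier A. \<forall>y\<in>carrier A.
        \<delta> (x \<otimes>\<^bsub>A\<^esub> y) = (\<delta> x \<otimes>\<^bsub>A\<^esub> y) \<oplus>\<^bsub>A\<^esub> (x \<otimes>\<^bsub>A\<^esub> \<delta> y))"

end

theory Submission
  imports Defs
begin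

text \<open>
  Fix a vector \<open>x\<^sub>0\<close> and a functional \<open>\<phi>\<^sub>0\<close> with \<open>\<phi>\<^sub>0 x\<^sub>0 = 1\<close>, write \<open>u \<otimes> \<phi>\<close> for the rank one operator
  \<open>x \<mapsto> \<phi> x u\<close>, and put \<open>W u = \<delta> (u \<otimes> \<phi>\<^sub>0) x\<^sub>0\<close> for a measurable function \<open>u\<close> from \<open>S\<close> to \<open>X\<close>. Since
  \<open>T (h \<otimes> \<phi>\<^sub>0) = T h \<otimes> \<phi>\<^sub>0\<close>, the product rule evaluated at \<open>x\<^sub>0\<close> says
  \<open>\<delta> T h = W (T h) - T (W h)\<close> almost everywhere. So \<open>\<delta> T\<close> is the commutator of \<open>W\<close> and \<open>T\<close>, and what
  has to be shown is that the map \<open>W\<close>, which is a priori only complex linear on functions, is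
  given by a bounded operator \<open>w s\<close> at almost every point \<open>s\<close>.

  The commutator relation itself forces this. First, \<open>W\<close> is local: a function that vanishes on \<open>E\<close>
  can be written \<open>u = (u \<otimes> \<phi>\<^sub>0) h\<close> with \<open>h\<close> vanishing on \<open>E\<close>, and then both terms of \<open>W u\<close> vanish on
  \<open>E\<close> (\<open>vanishing_local\<close>). Second, \<open>W\<close> is bounded on every countable family of functions of norm at most
  one (\<open>countable_family_bounded\<close>). This is a gliding hump argument and uses infinite dimension: take a
  biorthogonal sequence \<open>x\<^sub>n\<close>, \<open>\<phi>\<^sub>n\<close> and small constants \<open>\<alpha>\<^sub>n > 0\<close>. If the values of \<open>W\<close> on the family
  were unbounded at the points of a set of positive measure, locality would allow gluing members of
  the family to functions \<open>k\<^sub>n\<close> for which \<open>W k\<^sub>n\<close> grows faster than any prescribed rate there. The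
  compact-valued \<open>T = \<Sum>n. \<alpha>\<^sub>n k\<^sub>n \<otimes> \<phi>\<^sub>n\<close> maps \<open>x\<^sub>n\<close> to \<open>\<alpha>\<^sub>n k\<^sub>n\<close>, so that
  \<open>\<alpha>\<^sub>n W k\<^sub>n = \<delta> T x\<^sub>n + T (W x\<^sub>n)\<close> is at almost every point at most a
  constant times \<open>norm x\<^sub>n + norm (W x\<^sub>n)\<close>. This rate does not depend on the \<open>k\<^sub>n\<close>, a contradiction.

  Boundedness on constant functions from a countable dense set yields the operators \<open>w s\<close>. For a
  general \<open>u\<close>, approximate by functions \<open>v\<^sub>k\<close> that take countably many values, at distance
  \<open>2\<^sup>-\<^sup>k\<close>; boundedness on the countable family \<open>2\<^sup>k (u - v\<^sub>k)\<close> lets \<open>W v\<^sub>k = w v\<^sub>k\<close> pass to the limit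
  (\<open>pointwise_representation\<close>). Up to this point only rank one operators and norm convergent sums of
  them are inserted into \<open>\<delta>\<close>, which is why one argument serves both algebras.

  Two facts about Banach spaces enter: norming functionals exist (Hahn-Banach), and weakly measurable
  functions into a separable space have measurable norms (Pettis).
\<close>

section \<open>Norming functionals\<close>

text \<open>Positive homogeneity is only required as an inequality; rescaling by the inverse gives the
  equality, so checking sublinearity of an infimum takes one direction only.\<close>
definition sublinear :: "('a :: real_vector \<Rightarrow> real) \<Rightarrow> bool" where
  "sublinear p \<longleftrightarrow> (\<forall>x y. p (x + y) \<le> p x + p y) \<and> (\<forall>t x. 0 \<le> t \<longrightarrow> p (t *\<^sub>R x) \<le> t * p x)"

lemma sublinearD:
  assumes "sublinear p"
  shows "p (x + y) \<le> p x + p y" and "0 \<le> t \<Longrightarrow> p (t *\<^sub>R x) \<le> t * p x"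
    and "p 0 = 0" and "- p (- x) \<le> p x"
proof -
  show add: "p (x + y) \<le> p x + p y" for x y
    using assms by (auto simp: sublinear_def)
  show hom: "p (t *\<^sub>R x) \<le> t * p x" if "0 \<le> t" for t x
    using assms that by (auto simp: sublinear_def)
  show 0: "p 0 = 0"
    using add[of 0 0] hom[of 0 0] by simp
  show "- p (- x) \<le> p x"
    using add[of x "- x"] 0 by simp
qed

text \<open>This is the largest sublinear functional below \<open>p\<close> that takes the value \<open>- p y\<close> at \<open>- y\<close>.
  It serves twice: to see that minimal sublinear functionals are linear, and to prescribe the value
  at a given vector.\<close>
definition flatten :: "('a :: real_vector \<Rightarrow> real) \<Rightarrow> 'a \<Rightarrow> 'a \<Rightarrow> real" where
  "flatten p y x = (INF t\<in>{0..}. p (x + t *\<^sub>R y) - t * p y)"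

lemma flatten_le:
  assumes "sublinear p" and "0 \<le> t"
  shows "flatten p y x \<le> p (x + t *\<^sub>R y) - t * p y"
  unfolding flatten_def
proof (rule cINF_lower)
  show "bdd_below ((\<lambda>t. p (x + t *\<^sub>R y) - t * p y) ` {0..})"
  proof (rule bdd_belowI2)
    fix t :: real assume "t \<in> {0..}"
    then have t: "0 \<le> t" by simp
    have "t * p y \<le> p (t *\<^sub>R y)"
    proof (cases "t = 0")
      case False
      with sublinearD(2)[OF assms(1), of "inverse t" "t *\<^sub>R y"] t
      have "p y \<le> inverse t * p (t *\<^sub>R y)" by simp
      with False t show ?thesis by (simp add: field_simps)
    qed (simp add: sublinearD(3)[OF assms(1)])
    also have "p (t *\<^sub>R y) \<le> p (x + t *\<^sub>R y) + p (- x)"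
      using sublinearD(1)[OF assms(1), of "x + t *\<^sub>R y" "- x"] by simp
    finally show "- p (- x) \<le> p (x + t *\<^sub>R y) - t * p y" by simp
  qed
qed (use assms in simp)

lemma sublinear_flatten:
  assumes p: "sublinear p"
  shows "sublinear (flatten p y)"
  unfolding sublinear_def
proof (intro conjI allI impI)
  fix x x'
  have "flatten p y (x + x') - (p (x + t *\<^sub>R y) - t * p y) \<le> flatten p y x'" if "0 \<le> t" for t
    unfolding flatten_def[of p y x']
  proof (rule cINF_greatest)
    fix r :: real assume "r \<in> {0..}"
    then have "flatten p y (x + x') \<le> p (x + x' + (t + r) *\<^sub>R y) - (t + r) * p y"
      using that by (intro flatten_le[OF p]) auto
    also have "x + x' + (t + r) *\<^sub>R y = (x + t *\<^sub>R y) + (x' + r *\<^sub>R y)"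
      by (simp add: algebra_simps)
    also have "p \<dots> \<le> p (x + t *\<^sub>R y) + p (x' + r *\<^sub>R y)"
      by (rule sublinearD(1)[OF p])
    finally show "flatten p y (x + x') - (p (x + t *\<^sub>R y) - t * p y) \<le> p (x' + r *\<^sub>R y) - r * p y"
      by (simp add: algebra_simps)
  qed simp
  then have "flatten p y (x + x') - flatten p y x' \<le> flatten p y x"
    unfolding flatten_def[of p y x]
    by (intro cINF_greatest) (auto simp: algebra_simps)
  then show "flatten p y (x + x') \<le> flatten p y x + flatten p y x'" by simp
next
  fix r :: real and x assume "0 \<le> r"
  show "flatten p y (r *\<^sub>R x) \<le> r * flatten p y x"
  proof (cases "r = 0")
    case True
    then show ?thesis
      using flatten_le[OF p, of 0 y 0] by (simp add: sublinearD(3)[OF p])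
  next
    case False
    with \<open>0 \<le> r\<close> have "0 < r" by simp
    have "flatten p y (r *\<^sub>R x) / r \<le> flatten p y x"
      unfolding flatten_def[of p y x]
    proof (rule cINF_greatest)
      fix t :: real assume "t \<in> {0..}"
      then have "flatten p y (r *\<^sub>R x) \<le> p (r *\<^sub>R x + (r * t) *\<^sub>R y) - (r * t) * p y"
        using \<open>0 < r\<close> by (intro flatten_le[OF p]) auto
      also have "r *\<^sub>R x + (r * t) *\<^sub>R y = r *\<^sub>R (x + t *\<^sub>R y)"
        by (simp add: algebra_simps)
      also have "p \<dots> \<le> r * p (x + t *\<^sub>R y)"
        using \<open>0 < r\<close> by (intro sublinearD(2)[OF p]) auto
      finally show "flatten p y (r *\<^sub>R x) / r \<le> p (x + t *\<^sub>R y) - t * p y"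
        using \<open>0 < r\<close> by (simp add: field_simps)
    qed simp
    with \<open>0 < r\<close> show ?thesis by (simp add: field_simps)
  qed
qed

text \<open>Zorn's lemma applies because the pointwise infimum of a chain below \<open>p\<close> is finite: a sublinear
  \<open>q \<le> p\<close> satisfies \<open>q x \<ge> - q (- x) \<ge> - p (- x)\<close>.\<close>
lemma minimal_sublinear_exists:
  fixes p :: "'a :: real_vector \<Rightarrow> real"
  assumes p: "sublinear p"
  obtains m where "sublinear m" and "m \<le> p" and "\<And>q. sublinear q \<Longrightarrow> q \<le> m \<Longrightarrow> q = m"
proof -
  define A where "A = {q. sublinear q \<and> q \<le> p}"
  have "\<exists>m\<in>A. \<forall>q\<in>A. q \<le> m \<longrightarrow> q = m"
  proof (rule predicate_Zorn)
    show "partial_order_on A (relation_of (\<lambda>q r :: 'a \<Rightarrow> real. r \<le> q) A)"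
      by (rule partial_order_on_relation_ofI) auto
  next
    fix C assume C: "C \<in> Chains (relation_of (\<lambda>q r :: 'a \<Rightarrow> real. r \<le> q) A)"
    then have CA: "C \<subseteq> A" and total: "q \<le> r \<or> r \<le> q" if "q \<in> C" "r \<in> C" for q r
      using that by (auto simp: Chains_def relation_of_def)
    show "\<exists>u\<in>A. \<forall>a\<in>C. u \<le> a"
    proof (cases "C = {}")
      case True
      then show ?thesis using p by (auto simp: A_def)
    next
      case False
      define u where "u x = (INF q\<in>C. q x)" for x
      have bdd: "bdd_below ((\<lambda>q. q x) ` C)" for x
      proof (rule bdd_belowI2)
        fix q assume "q \<in> C"
        with CA have "sublinear q" "q \<le> p" by (auto simp: A_def)
        then show "- p (- x) \<le> q x"
          using sublinearD(4)[of q x] le_funD[of q p "- x"] by linarith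
      qed
      have lower: "u x \<le> q x" if "q \<in> C" for q x
        unfolding u_def using bdd that by (rule cINF_lower)
      have "sublinear u"
        unfolding sublinear_def
      proof (intro conjI allI impI)
        fix x y
        have *: "u (x + y) \<le> q x + r y" if qr: "q \<in> C" "r \<in> C" for q r
        proof -
          obtain m where m: "m \<in> C" "m \<le> q" "m \<le> r"
            using total[OF qr] qr by auto
          with CA have "sublinear m" by (auto simp: A_def)
          then have "m (x + y) \<le> m x + m y" by (rule sublinearD)
          with lower[OF m(1), of "x + y"] le_funD[OF m(2), of x] le_funD[OF m(3), of y]
          show ?thesis by linarith
        qed
        have "u (x + y) - q x \<le> u y" if "q \<in> C" for q
          unfolding u_def[of y] using *[OF that] by (intro cINF_greatest False) (auto simp: algebra_simps)
        then have "u (x + y) - u y \<le> u x"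
          unfolding u_def[of x] by (intro cINF_greatest False) (auto simp: algebra_simps)
        then show "u (x + y) \<le> u x + u y" by simp
      next
        fix t :: real and x assume t: "0 \<le> t"
        have *: "u (t *\<^sub>R x) \<le> t * q x" if "q \<in> C" for q
        proof -
          have "sublinear q" using that CA by (auto simp: A_def)
          from sublinearD(2)[OF this t, of x] lower[OF that, of "t *\<^sub>R x"] show ?thesis by simp
        qed
        show "u (t *\<^sub>R x) \<le> t * u x"
        proof (cases "t = 0")
          case True
          with * False show ?thesis by auto
        next
          case False
          with t have "0 < t" by simp
          then have "u (t *\<^sub>R x) / t \<le> u x"
            unfolding u_def[of x] using * \<open>C \<noteq> {}\<close>
            by (intro cINF_greatest) (auto simp: field_simps)
          with \<open>0 < t\<close> show ?thesis by (simp add: field_simps)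
        qed
      qed
      moreover obtain q where "q \<in> C" using False by blast
      with CA have "q \<le> p" by (auto simp: A_def)
      with lower[OF \<open>q \<in> C\<close>] have "u \<le> p"
        by (meson le_fun_def order_trans)
      ultimately show ?thesis
        using lower by (intro bexI[of _ u]) (auto simp: A_def le_fun_def)
    qed
  qed
  then obtain m where "m \<in> A" and min: "\<And>q. q \<in> A \<Longrightarrow> q \<le> m \<Longrightarrow> q = m" by blast
  then show ?thesis
    by (intro that[of m]) (auto simp: A_def)
qed

text \<open>A minimal sublinear functional \<open>m\<close> equals \<open>flatten m y\<close> for each \<open>y\<close>, and evaluating the infimum
  at \<open>t = 1\<close> gives \<open>m x \<le> m (x + y) - m y\<close>, the missing half of additivity.\<close>
theorem Hahn_Banach_sublinear:
  fixes p :: "'a :: real_vector \<Rightarrow> real"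
  assumes "sublinear p"
  obtains u where "linear u" and "u \<le> p"
proof -
  obtain m where m: "sublinear m" "m \<le> p" and min: "\<And>q. sublinear q \<Longrightarrow> q \<le> m \<Longrightarrow> q = m"
    using minimal_sublinear_exists[OF assms] by blast
  have add: "m (x + y) = m x + m y" for x y
  proof (rule antisym)
    have "flatten m y = m"
      using flatten_le[OF m(1), of 0 y] by (intro min sublinear_flatten m le_funI) simp
    with flatten_le[OF m(1), of 1 y x] show "m x + m y \<le> m (x + y)" by simp
  qed (rule sublinearD[OF m(1)])
  have neg: "m (- x) = - m x" for x
    using add[of x "- x"] sublinearD(3)[OF m(1)] by simp
  have le: "m (t *\<^sub>R x) = t * m x" if "0 \<le> t" for t x
  proof (rule antisym)
    show "m (t *\<^sub>R x) \<le> t * m x" using m(1) that by (rule sublinearD)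
    show "t * m x \<le> m (t *\<^sub>R x)"
      using sublinearD(2)[OF m(1) that, of "- x"] by (simp add: neg)
  qed
  have "m (t *\<^sub>R x) = t * m x" for t x
    using le[of t x] le[of "- t" x] neg[of "t *\<^sub>R x"] by (cases "0 \<le> t") auto
  with add have "linear m" by (intro linearI) auto
  from this m(2) show ?thesis by (rule that)
qed

lemma bounded_bilinear_scaleC:
  "bounded_bilinear (scaleC :: complex \<Rightarrow> 'a :: complex_banach \<Rightarrow> 'a)"
proof (rule bounded_bilinear.intro)
  fix a b :: complex and r :: real and x y :: 'a
  show "(r *\<^sub>R a) *\<^sub>C x = r *\<^sub>R (a *\<^sub>C x)"
    by (simp add: scaleR_conv_of_real scaleC_scaleC[symmetric] scaleC_of_real)
  show "a *\<^sub>C (r *\<^sub>R x) = r *\<^sub>R (a *\<^sub>C x)"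
    by (metis scaleC_of_real scaleC_scaleC mult.commute)
  show "\<exists>K. \<forall>c (x :: 'a). norm (c *\<^sub>C x) \<le> norm c * norm x * K"
    by (rule exI[of _ 1]) (simp add: norm_scaleC)
qed (simp_all add: scaleC_add_left scaleC_add_right)

interpretation scaleC: bounded_bilinear "scaleC :: complex \<Rightarrow> 'a :: complex_banach \<Rightarrow> 'a"
  by (rule bounded_bilinear_scaleC)

interpretation complex_vs: vector_space "scaleC :: complex \<Rightarrow> 'a :: complex_banach \<Rightarrow> 'a"
  by (rule vector_space_scaleC)

lemma bounded_ops_scaleC: "T \<in> bounded_ops \<Longrightarrow> blinfun_apply T (c *\<^sub>C x) = c *\<^sub>C blinfun_apply T x"
  by (simp add: bounded_ops_def)

text \<open>Starting Hahn-Banach from \<open>flatten norm x\<close> instead of the norm pins the value at \<open>x\<close> to \<open>norm x\<close>.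
  A real functional \<open>u\<close> is the real part of the complex one \<open>y \<mapsto> u y - \<i> u (\<i> y)\<close>. Its real
  part obeys the sharp bound, which is what recovering the norm as a supremum takes.\<close>
theorem norming_functional_exists:
  fixes x :: "'a :: complex_banach"
  obtains \<phi> :: "'a \<Rightarrow>\<^sub>L complex"
  where "\<phi> \<in> bounded_ops" and "Re (\<phi> x) = norm x" and "\<And>y. Re (\<phi> y) \<le> norm y"
proof -
  have nrm: "sublinear (norm :: 'a \<Rightarrow> real)"
    by (simp add: sublinear_def norm_triangle_ineq)
  obtain u where lin: "linear u" and u: "u \<le> flatten norm x"
    using Hahn_Banach_sublinear[OF sublinear_flatten[OF nrm]] by blast
  interpret u: linear u by (rule lin)
  have le: "u y \<le> norm y" for y
    using le_funD[OF u, of y] flatten_le[OF nrm, of 0 x y] by simp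
  have abs: "\<bar>u y\<bar> \<le> norm y" for y
    using le[of y] le[of "- y"] by (simp add: u.neg)
  have "u (- x) \<le> - norm x"
    using le_funD[OF u, of "- x"] flatten_le[OF nrm, of 1 x "- x"] by simp
  with le[of x] have ux: "u x = norm x" by (simp add: u.neg)
  define f where "f y = Complex (u y) (- u (\<i> *\<^sub>C y))" for y
  have "bounded_linear f"
  proof (rule bounded_linear_intro[where K = 2])
    show "f (a + b) = f a + f b" for a b
      by (simp add: f_def scaleC_add_right u.add complex_eq_iff)
    show "f (r *\<^sub>R a) = r *\<^sub>R f a" for r a
      by (simp add: f_def scaleC.scaleR_right u.scale complex_eq_iff)
    show "norm (f a) \<le> norm a * 2" for a
    proof -
      have "norm (f a) \<le> \<bar>u a\<bar> + \<bar>u (\<i> *\<^sub>C a)\<bar>"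
        using cmod_le[of "f a"] by (simp add: f_def)
      also have "\<dots> \<le> norm a + norm a"
        using abs[of a] abs[of "\<i> *\<^sub>C a"] by (simp add: norm_scaleC)
      finally show ?thesis by simp
    qed
  qed
  then have app: "blinfun_apply (Blinfun f) = f" by (rule bounded_linear_Blinfun_apply)
  have "f (c *\<^sub>C y) = c * f y" for c y
  proof -
    have c: "c *\<^sub>C y = Re c *\<^sub>R y + Im c *\<^sub>R (\<i> *\<^sub>C y)"
    proof -
      have "c = of_real (Re c) + of_real (Im c) * \<i>"
        by (simp add: complex_eq_iff)
      then have "c *\<^sub>C y = (of_real (Re c) + of_real (Im c) * \<i>) *\<^sub>C y" by simp
      then show ?thesis
        by (simp only: scaleC_add_left scaleC_scaleC[symmetric] scaleC_of_real)
    qed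
    have ic: "\<i> *\<^sub>C (c *\<^sub>C y) = Re c *\<^sub>R (\<i> *\<^sub>C y) - Im c *\<^sub>R y"
    proof -
      have "\<i> *\<^sub>C \<i> *\<^sub>C y = - y"
        unfolding scaleC_scaleC by (simp add: complex_vs.scale_minus_left scaleC_one)
      then show ?thesis
        unfolding c by (simp add: scaleC_add_right scaleC.scaleR_right)
    qed
    show ?thesis
      unfolding f_def ic unfolding c
      by (simp add: u.add u.diff u.scale complex_eq_iff)
  qed
  then have "Blinfun f \<in> bounded_ops"
    by (simp add: bounded_ops_def app scaleC_complex_def)
  then show ?thesis
    by (rule that) (simp_all add: app f_def ux le)
qed

text \<open>Given finitely many biorthogonal pairs, \<open>Q = 1 - \<Sum>i. x\<^sub>i \<otimes> \<phi>\<^sub>i\<close> kills every \<open>x\<^sub>i\<close> and is killed by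
  every \<open>\<phi>\<^sub>i\<close>, and it is nonzero because the \<open>x\<^sub>i\<close> do not span the space. A vector \<open>z\<close> in its range and
  a multiple of \<open>\<psi> \<circ> Q\<close> with \<open>\<psi> z \<noteq> 0\<close> are the next pair.\<close>
lemma biorthogonal_sequence_exists:
  assumes "infinite_dim TYPE('a :: complex_banach)"
  obtains x :: "nat \<Rightarrow> 'a :: complex_banach" and \<phi> :: "nat \<Rightarrow> 'a \<Rightarrow>\<^sub>L complex"
  where "\<And>n. \<phi> n \<in> bounded_ops" and "\<And>m n. blinfun_apply (\<phi> m) (x n) = (if m = n then 1 else 0)"
proof -
  define P where "P f n r \<longleftrightarrow> snd r \<in> bounded_ops \<and> blinfun_apply (snd r) (fst r) = 1 \<and>
      (\<forall>i<n. blinfun_apply (snd r) (fst (f i)) = 0 \<and> blinfun_apply (snd (f i)) (fst r) = 0)"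
    for f :: "nat \<Rightarrow> 'a \<times> ('a \<Rightarrow>\<^sub>L complex)" and n
      and r :: "'a \<times> ('a \<Rightarrow>\<^sub>L complex)"
  have "\<exists>f. \<forall>n. P f n (f n)"
  proof (rule dependent_wellorder_choice)
    show "P f n r = P g n r" if "\<And>i. i < n \<Longrightarrow> f i = g i" for r f g n
      using that by (auto simp: P_def)
  next
    fix n :: nat and f assume IH: "\<And>i. i < n \<Longrightarrow> P f i (f i)"
    define x where "x i = fst (f i)" for i
    define \<phi> where "\<phi> i = snd (f i)" for i
    have ops: "\<phi> i \<in> bounded_ops" if "i < n" for i
      using IH[OF that] by (simp add: P_def \<phi>_def)
    have bi: "blinfun_apply (\<phi> i) (x j) = (if i = j then 1 else 0)" if "i < n" "j < n" for i j
      using IH[OF that(1)] IH[OF that(2)] by (cases i j rule: linorder_cases) (auto simp: P_def \<phi>_def x_def)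
    define Q where "Q y = y - (\<Sum>i<n. blinfun_apply (\<phi> i) y *\<^sub>C x i)" for y
    have \<phi>Q: "blinfun_apply (\<phi> i) (Q y) = 0" if "i < n" for i y
    proof -
      have "blinfun_apply (\<phi> i) (Q y)
          = blinfun_apply (\<phi> i) y - (\<Sum>j<n. blinfun_apply (\<phi> j) y * blinfun_apply (\<phi> i) (x j))"
        by (simp add: Q_def blinfun.diff_right blinfun.sum_right bounded_ops_scaleC[OF ops[OF that]]
            scaleC_complex_def)
      also have "\<dots> = 0"
        using that by (simp add: bi if_distrib[of "\<lambda>z. _ * z"] cong: if_cong)
      finally show ?thesis .
    qed
    have "\<exists>y. Q y \<noteq> 0"
    proof (rule ccontr)
      assume "\<nexists>y. Q y \<noteq> 0"
      then have Q0: "Q y = 0" for y by blast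
      have "y \<in> complex_vs.span (x ` {..<n})" for y
      proof -
        have "y = (\<Sum>i<n. blinfun_apply (\<phi> i) y *\<^sub>C x i)" using Q0[of y] by (simp add: Q_def)
        also have "\<dots> \<in> complex_vs.span (x ` {..<n})"
          by (intro complex_vs.span_sum complex_vs.span_scale complex_vs.span_base) auto
        finally show ?thesis .
      qed
      then have "complex_vs.span (x ` {..<n}) = UNIV" by blast
      with assms show False
        unfolding infinite_dim_def by blast
    qed
    then obtain y where y: "Q y \<noteq> 0" by blast
    define z where "z = Q y"
    obtain \<psi> :: "'a \<Rightarrow>\<^sub>L complex" where \<psi>: "\<psi> \<in> bounded_ops" "Re (\<psi> z) = norm z"
      using norming_functional_exists[of z] by blast
    with y have \<psi>z: "blinfun_apply \<psi> z \<noteq> 0" by (auto simp: z_def)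
    have Qz: "Q z = z"
      unfolding Q_def[of z] using \<phi>Q by (simp add: z_def)
    have Qx: "Q (x i) = 0" if "i < n" for i
      unfolding Q_def using that
      by (simp add: bi if_distrib[of "\<lambda>c. c *\<^sub>C _"] scaleC_one cong: if_cong)
    have blQ: "bounded_linear Q"
      unfolding Q_def
      by (intro bounded_linear_sub bounded_linear_ident bounded_linear_sum scaleC.bounded_linear_left
          bounded_linear_compose[OF scaleC.bounded_linear_left] blinfun.bounded_linear_right)
    have QC: "Q (c *\<^sub>C v) = c *\<^sub>C Q v" for c v
      by (simp add: Q_def complex_vs.scale_right_diff_distrib complex_vs.scale_sum_right
          bounded_ops_scaleC[OF ops] scaleC_complex_def)
    define \<eta> where "\<eta> = blinfun_scaleC (inverse (blinfun_apply \<psi> z)) (\<psi> o\<^sub>L Blinfun Q)"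
    have \<eta>: "blinfun_apply \<eta> v = inverse (blinfun_apply \<psi> z) * blinfun_apply \<psi> (Q v)" for v
      by (simp add: \<eta>_def blinfun_scaleC.rep_eq scaleC_complex_def bounded_linear_Blinfun_apply[OF blQ])
    have "P f n (z, \<eta>)"
      unfolding P_def using \<psi>z \<phi>Q
      by (auto simp: \<eta> bounded_ops_def QC bounded_ops_scaleC[OF \<psi>(1)] scaleC_complex_def Qz
          Qx[unfolded x_def] z_def[symmetric] \<phi>_def blinfun.zero_right) (simp add: z_def)
    then show "\<exists>r. P f n r" by blast
  qed
  then obtain f where f: "\<And>n. P f n (f n)" by blast
  show ?thesis
  proof (rule that[of "\<lambda>n. snd (f n)" "\<lambda>n. fst (f n)"])
    show "snd (f n) \<in> bounded_ops" for n using f[of n] by (simp add: P_def)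
    show "blinfun_apply (snd (f m)) (fst (f n)) = (if m = n then 1 else 0)" for m n
      using f[of n] f[of m] by (cases m n rule: linorder_cases) (auto simp: P_def)
  qed
qed


section \<open>Weakly measurable functions with values in a separable space\<close>

text \<open>Measurability of vector functions is tested on scalars only. Sums, limits and countable gluings
  of such functions then need no argument in the vector space; the price is that measurability of
  the norm becomes a theorem.\<close>
definition weakly_measurable :: "'s measure \<Rightarrow> ('s \<Rightarrow> 'a :: complex_banach) set" where
  "weakly_measurable M = {h. \<forall>\<phi> \<in> (bounded_ops :: ('a \<Rightarrow>\<^sub>L complex) set).
     (\<lambda>s. blinfun_apply \<phi> (h s)) \<in> borel_measurable M}"

lemma weakly_measurableI:
  "(\<And>\<phi> :: 'a \<Rightarrow>\<^sub>L complex. \<phi> \<in> bounded_ops \<Longrightarrow> (\<lambda>s. blinfun_apply \<phi> (h s)) \<in> borel_measurable M)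
    \<Longrightarrow> h \<in> weakly_measurable M" for h :: "'s \<Rightarrow> 'a :: complex_banach"
  by (simp add: weakly_measurable_def)

lemma weakly_measurableD:
  "h \<in> weakly_measurable M \<Longrightarrow> \<phi> \<in> bounded_ops \<Longrightarrow> (\<lambda>s. blinfun_apply \<phi> (h s)) \<in> borel_measurable M"
  for \<phi> :: "'a :: complex_banach \<Rightarrow>\<^sub>L complex"
  by (simp add: weakly_measurable_def)

lemma weakly_measurable_const: "(\<lambda>_. x) \<in> weakly_measurable M"
  by (simp add: weakly_measurable_def)

lemma weakly_measurable_add:
  "u \<in> weakly_measurable M \<Longrightarrow> v \<in> weakly_measurable M \<Longrightarrow> (\<lambda>s. u s + v s) \<in> weakly_measurable M"
  unfolding weakly_measurable_def by (auto simp: blinfun.add_right intro!: borel_measurable_add)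

lemma weakly_measurable_scaleC:
  "c \<in> borel_measurable M \<Longrightarrow> u \<in> weakly_measurable M \<Longrightarrow> (\<lambda>s. c s *\<^sub>C u s) \<in> weakly_measurable M"
  by (intro weakly_measurableI)
    (simp add: bounded_ops_scaleC scaleC_complex_def weakly_measurableD borel_measurable_times)

lemma weakly_measurable_cscale:
  "u \<in> weakly_measurable M \<Longrightarrow> (\<lambda>s. c *\<^sub>C u s) \<in> weakly_measurable M"
  by (rule weakly_measurable_scaleC) simp

lemma weakly_measurable_diff:
  assumes "u \<in> weakly_measurable M" "v \<in> weakly_measurable M"
  shows "(\<lambda>s. u s - v s) \<in> weakly_measurable M"
  using assms unfolding weakly_measurable_def
  by (auto simp: blinfun.diff_right intro!: borel_measurable_diff)

lemma weakly_measurable_LIMSEQ: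
  assumes "\<And>k. h k \<in> weakly_measurable M"
    and "\<And>s. s \<in> space M \<Longrightarrow> (\<lambda>k. h k s) \<longlonglongrightarrow> u s"
  shows "u \<in> weakly_measurable M"
proof (rule weakly_measurableI)
  fix \<phi> :: "'b \<Rightarrow>\<^sub>L complex" assume \<phi>: "\<phi> \<in> bounded_ops"
  show "(\<lambda>s. blinfun_apply \<phi> (u s)) \<in> borel_measurable M"
  proof (rule borel_measurable_LIMSEQ_metric)
    show "(\<lambda>s. blinfun_apply \<phi> (h k s)) \<in> borel_measurable M" for k
      using assms(1) \<phi> by (rule weakly_measurableD)
    show "(\<lambda>k. blinfun_apply \<phi> (h k s)) \<longlonglongrightarrow> blinfun_apply \<phi> (u s)" if "s \<in> space M" for s
      using assms(2)[OF that] by (rule blinfun.tendsto[OF tendsto_const])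
  qed
qed

lemma weakly_measurable_glue:
  fixes h :: "nat \<Rightarrow> 's \<Rightarrow> 'a :: complex_banach"
  assumes "i \<in> measurable M (count_space UNIV)" and "\<And>n. h n \<in> weakly_measurable M"
  shows "(\<lambda>s. h (i s) s) \<in> weakly_measurable M"
proof (rule weakly_measurableI)
  fix \<phi> :: "'a \<Rightarrow>\<^sub>L complex" assume "\<phi> \<in> bounded_ops"
  with assms(2) have "(\<lambda>s. blinfun_apply \<phi> (h n s)) \<in> borel_measurable M" for n
    by (rule weakly_measurableD)
  then show "(\<lambda>s. blinfun_apply \<phi> (h (i s) s)) \<in> borel_measurable M"
    by (rule measurable_compose_countable[OF _ assms(1)])
qed

lemma wo_measurable_iff:
  "f \<in> wo_measurable M B \<longleftrightarrow> f \<in> space M \<rightarrow> B \<and> (\<forall>x. (\<lambda>s. blinfun_apply (f s) x) \<in> weakly_measurable M)"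
  by (auto simp: wo_measurable_def weakly_measurable_def)

text \<open>Separability in the form of an enumeration, so that approximating members of the dense set can be
  selected by their least index, which is a measurable choice.\<close>
locale dense_sequence =
  fixes q :: "nat \<Rightarrow> 'a :: complex_banach"
  assumes dense: "0 < e \<Longrightarrow> \<exists>i. norm (x - q i) < e"
begin

definition nearest :: "nat \<Rightarrow> 'a \<Rightarrow> nat" where
  "nearest k x = (LEAST i. norm (x - q i) < (1 / 2) ^ k)"

lemma norm_nearest: "norm (x - q (nearest k x)) < (1 / 2) ^ k"
  unfolding nearest_def by (rule LeastI_ex) (simp add: dense)

lemma nearest_tendsto: "(\<lambda>k. q (nearest k x)) \<longlonglongrightarrow> x"
proof -
  have "(\<lambda>k. norm (q (nearest k x) - x)) \<longlonglongrightarrow> 0"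
  proof (rule tendsto_sandwich[OF _ _ tendsto_const])
    show "\<forall>\<^sub>F k in sequentially. norm (q (nearest k x) - x) \<le> (1 / 2) ^ k"
      using norm_nearest by (intro always_eventually) (auto simp: norm_minus_commute less_imp_le)
    show "(\<lambda>k. (1 / 2) ^ k :: real) \<longlonglongrightarrow> 0" by (rule LIMSEQ_power_zero) simp
  qed simp
  then show ?thesis by (simp add: LIM_zero_iff tendsto_norm_zero_iff)
qed

text \<open>Norming functionals of the members of a dense sequence determine the norm as a countable
  supremum. This is the part of Pettis' theorem that is needed.\<close>
lemma norm_measurable:
  assumes "h \<in> weakly_measurable M"
  shows "(\<lambda>s. norm (h s :: 'a)) \<in> borel_measurable M"
proof -
  have "\<forall>i. \<exists>\<phi> :: 'a \<Rightarrow>\<^sub>L complex.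
      \<phi> \<in> bounded_ops \<and> Re (\<phi> (q i)) = norm (q i) \<and> (\<forall>y. Re (\<phi> y) \<le> norm y)"
  proof
    show "\<exists>\<phi> :: 'a \<Rightarrow>\<^sub>L complex. \<phi> \<in> bounded_ops \<and> Re (\<phi> (q i)) = norm (q i) \<and> (\<forall>y. Re (\<phi> y) \<le> norm y)"
      for i by (rule norming_functional_exists[of "q i"]) blast
  qed
  from choice[OF this] obtain \<phi> :: "nat \<Rightarrow> 'a \<Rightarrow>\<^sub>L complex" where
    ops: "\<And>i. \<phi> i \<in> bounded_ops" and q: "\<And>i. Re (\<phi> i (q i)) = norm (q i)"
    and le: "\<And>i y. Re (\<phi> i y) \<le> norm y"
    by blast
  have bdd: "bdd_above (range (\<lambda>i. Re (\<phi> i y)))" for y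
    using le by (intro bdd_aboveI2)
  have "norm y = (SUP i. Re (\<phi> i y))" for y
  proof (rule antisym)
    show "(SUP i. Re (\<phi> i y)) \<le> norm y" using le by (intro cSUP_least) auto
    show "norm y \<le> (SUP i. Re (\<phi> i y))"
    proof (rule field_le_epsilon)
      fix e :: real assume "0 < e"
      then obtain i where i: "norm (y - q i) < e / 2" using dense[of "e / 2" y] by auto
      have "norm y \<le> norm (q i) + norm (y - q i)" by (rule norm_triangle_sub)
      also have "norm (q i) = Re (\<phi> i y) + Re (\<phi> i (q i - y))"
        using q[of i] by (simp add: blinfun.diff_right)
      also have "Re (\<phi> i (q i - y)) \<le> norm (y - q i)"
        using le[of i "q i - y"] by (simp add: norm_minus_commute)
      also have "Re (\<phi> i y) \<le> (SUP i. Re (\<phi> i y))"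
        by (rule cSUP_upper[OF _ bdd]) simp
      finally show "norm y \<le> (SUP i. Re (\<phi> i y)) + e" using i by simp
    qed
  qed
  then have "(\<lambda>s. norm (h s)) = (\<lambda>s. SUP i. Re (\<phi> i (h s)))" by simp
  also have "\<dots> \<in> borel_measurable M"
    using weakly_measurableD[OF assms ops] bdd by (intro borel_measurable_cSUP) auto
  finally show ?thesis .
qed

lemma nearest_measurable:
  assumes "h \<in> weakly_measurable M"
  shows "(\<lambda>s. nearest k (h s)) \<in> measurable M (count_space UNIV)"
proof -
  have [measurable]: "(\<lambda>s. norm (h s - q i)) \<in> borel_measurable M" for i
    by (intro norm_measurable weakly_measurable_diff weakly_measurable_const assms)
  show ?thesis unfolding nearest_def by measurable
qed

text \<open>Weak operator measurability only speaks about constant vectors. It extends to countably valued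
  functions by gluing, and to all functions because they are pointwise limits of such.\<close>
lemma weakly_measurable_apply:
  assumes f: "f \<in> wo_measurable M B" and h: "h \<in> weakly_measurable M"
  shows "(\<lambda>s. blinfun_apply (f s) (h s :: 'a)) \<in> weakly_measurable M"
proof (rule weakly_measurable_LIMSEQ)
  show "(\<lambda>s. blinfun_apply (f s) (q (nearest k (h s)))) \<in> weakly_measurable M" for k
    using f by (intro weakly_measurable_glue[OF nearest_measurable[OF h], of "\<lambda>i s. blinfun_apply (f s) (q i)"])
      (simp add: wo_measurable_iff)
  show "(\<lambda>k. blinfun_apply (f s) (q (nearest k (h s)))) \<longlonglongrightarrow> blinfun_apply (f s) (h s)" for s
    by (intro blinfun.tendsto tendsto_const nearest_tendsto)
qed

text \<open>A single inequality on the dense sequence carries all that an extension needs: \<open>c m = 0\<close> makes \<open>f\<close>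
  Lipschitz, and after passing to the limit the choice \<open>w = x + z *\<^sub>C y\<close> makes the right-hand side
  zero and gives linearity. Thus the dense set need not be a subspace.\<close>
lemma lipschitz_extension:
  fixes f :: "'a \<Rightarrow> 'a" and c :: "nat \<Rightarrow> complex"
  assumes c: "dense_sequence c" and 0: "0 \<in> range c"
    and bound: "\<And>i j l m. norm (f (q i) + c m *\<^sub>C f (q j) - f (q l)) \<le> K * norm (q i + c m *\<^sub>C q j - q l)"
  obtains T where "T \<in> bounded_ops" and "\<And>i. blinfun_apply T (q i) = f (q i)"
proof -
  interpret c: dense_sequence c by (rule c)
  have lip: "norm (f (q i) - f (q j)) \<le> K * norm (q i - q j)" for i j
  proof -
    obtain m where "c m = 0" using 0 by force
    with bound[of i m j j] show ?thesis by simp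
  qed
  define a where "a x k = q (nearest k x)" for x k
  have a: "a x \<longlonglongrightarrow> x" for x
    unfolding a_def by (rule nearest_tendsto)
  have "convergent (\<lambda>k. f (a x k))" for x
  proof (rule Cauchy_convergent, rule CauchyI)
    fix e :: real assume "0 < e"
    have "Cauchy (a x)" using a by (rule LIMSEQ_imp_Cauchy)
    with \<open>0 < e\<close> obtain N where N: "\<And>m n. m \<ge> N \<Longrightarrow> n \<ge> N \<Longrightarrow> norm (a x m - a x n) < e / (\<bar>K\<bar> + 1)"
      using CauchyD[of "a x" "e / (\<bar>K\<bar> + 1)"] by auto
    have "norm (f (a x m) - f (a x n)) < e" if "m \<ge> N" "n \<ge> N" for m n
    proof -
      have "norm (f (a x m) - f (a x n)) \<le> K * norm (a x m - a x n)"
        unfolding a_def by (rule lip)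
      also have "\<dots> \<le> (\<bar>K\<bar> + 1) * norm (a x m - a x n)"
        by (intro mult_right_mono) auto
      also have "\<dots> < (\<bar>K\<bar> + 1) * (e / (\<bar>K\<bar> + 1))"
        using N[OF that] by (intro mult_strict_left_mono) auto
      finally show ?thesis by simp
    qed
    then show "\<exists>N. \<forall>m\<ge>N. \<forall>n\<ge>N. norm (f (a x m) - f (a x n)) < e" by blast
  qed
  then obtain g where g: "\<And>x. (\<lambda>k. f (a x k)) \<longlonglongrightarrow> g x"
    unfolding convergent_def by metis
  have ext: "norm (g x + z *\<^sub>C g y - g w) \<le> K * norm (x + z *\<^sub>C y - w)" for x y w z
  proof (rule LIMSEQ_le)
    show "(\<lambda>k. norm (f (a x k) + c (c.nearest k z) *\<^sub>C f (a y k) - f (a w k)))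
        \<longlonglongrightarrow> norm (g x + z *\<^sub>C g y - g w)"
      by (intro tendsto_intros scaleC.tendsto g c.nearest_tendsto)
    show "(\<lambda>k. K * norm (a x k + c (c.nearest k z) *\<^sub>C a y k - a w k))
        \<longlonglongrightarrow> K * norm (x + z *\<^sub>C y - w)"
      by (intro tendsto_intros scaleC.tendsto a c.nearest_tendsto)
    show "\<exists>N. \<forall>k\<ge>N. norm (f (a x k) + c (c.nearest k z) *\<^sub>C f (a y k) - f (a w k))
        \<le> K * norm (a x k + c (c.nearest k z) *\<^sub>C a y k - a w k)"
      unfolding a_def using bound by blast
  qed
  have lin: "g (x + z *\<^sub>C y) = g x + z *\<^sub>C g y" for x y z
    using ext[of x z y "x + z *\<^sub>C y"] by simp
  have g0: "g 0 = 0"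
    using lin[of 0 1 0] by (simp add: scaleC_one)
  have add: "g (x + y) = g x + g y" for x y
    using lin[of x 1 y] by (simp add: scaleC_one)
  have hom: "g (z *\<^sub>C y) = z *\<^sub>C g y" for y z
    using lin[of 0 z y] g0 by simp
  have "bounded_linear g"
  proof (rule bounded_linear_intro[where K = K])
    show "g (r *\<^sub>R y) = r *\<^sub>R g y" for r y
      using hom[of "of_real r" y] by (simp add: scaleC_of_real)
    show "norm (g x) \<le> norm x * K" for x
      using ext[of x 0 0 0] g0 by (simp add: mult.commute)
  qed (rule add)
  note app = bounded_linear_Blinfun_apply[OF this]
  have "g (q i) = f (q i)" for i
  proof (rule LIMSEQ_unique[OF g])
    have "(\<lambda>k. norm (f (a (q i) k) - f (q i))) \<longlonglongrightarrow> 0"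
    proof (rule tendsto_sandwich[OF _ _ tendsto_const])
      show "\<forall>\<^sub>F k in sequentially. norm (f (a (q i) k) - f (q i)) \<le> K * norm (a (q i) k - q i)"
        unfolding a_def by (intro always_eventually allI lip)
      show "(\<lambda>k. K * norm (a (q i) k - q i)) \<longlonglongrightarrow> 0"
        using a[of "q i"] by (intro tendsto_mult_right_zero tendsto_norm_zero) (simp add: LIM_zero_iff)
    qed simp
    then show "(\<lambda>k. f (a (q i) k)) \<longlonglongrightarrow> f (q i)"
      by (simp add: LIM_zero_iff tendsto_norm_zero_iff)
  qed
  with hom show ?thesis
    by (intro that[of "Blinfun g"]) (auto simp: app bounded_ops_def)
qed

lemma bounded_operator_eqI:
  assumes "\<And>i. blinfun_apply S (q i) = blinfun_apply T (q i)"
  shows "S = T"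
proof (rule blinfun_eqI)
  fix x
  have "(\<lambda>k. blinfun_apply S (q (nearest k x))) \<longlonglongrightarrow> blinfun_apply S x"
    and "(\<lambda>k. blinfun_apply T (q (nearest k x))) \<longlonglongrightarrow> blinfun_apply T x"
    by (intro blinfun.tendsto tendsto_const nearest_tendsto)+
  with assms show "blinfun_apply S x = blinfun_apply T x"
    using LIMSEQ_unique by auto
qed

end

lemma separable_imp_dense_sequence:
  assumes "separable_space (euclidean :: 'a :: complex_banach topology)"
  obtains q :: "nat \<Rightarrow> 'a :: complex_banach" where "dense_sequence q"
proof -
  from assms obtain C :: "'a set" where C: "countable C" "closure C = UNIV"
    by (auto simp: separable_space_def)
  then have "C \<noteq> {}" by auto
  have "dense_sequence (from_nat_into C)"
  proof
    fix e :: real and x :: 'a assume "0 < e"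
    moreover have "x \<in> closure C" using C by simp
    ultimately obtain y where "y \<in> C" "dist y x < e"
      unfolding closure_approachable by blast
    moreover from this obtain i where "y = from_nat_into C i"
      using from_nat_into_surj[OF C(1)] by metis
    ultimately show "\<exists>i. norm (x - from_nat_into C i) < e"
      by (auto simp: dist_norm norm_minus_commute)
  qed
  then show ?thesis by (rule that)
qed

lemma dense_sequence_complex:
  obtains c :: "nat \<Rightarrow> complex" where "dense_sequence c" and "0 \<in> range c"
proof -
  obtain D :: "complex set" where D: "countable D" "\<And>X. open X \<Longrightarrow> X \<noteq> {} \<Longrightarrow> \<exists>d\<in>D. d \<in> X"
    using countable_dense_exists by blast
  define c where "c = from_nat_into (insert 0 D)"
  have rng: "range c = insert 0 D"
    unfolding c_def using D(1) by (intro range_from_nat_into) auto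
  have "dense_sequence c"
  proof
    fix e :: real and x assume "0 < e"
    with D(2)[of "ball x e"] obtain d where "d \<in> D" "dist x d < e" by auto
    with rng obtain i where "d = c i" by blast
    with \<open>dist x d < e\<close> show "\<exists>i. norm (x - c i) < e" by (auto simp: dist_norm)
  qed
  with rng show ?thesis by (intro that) auto
qed

section \<open>Series of rank one operators\<close>

lift_definition rank_one :: "'b :: complex_banach \<Rightarrow> ('a :: complex_banach \<Rightarrow>\<^sub>L complex) \<Rightarrow> 'a \<Rightarrow>\<^sub>L 'b"
  is "\<lambda>u \<phi> x. \<phi> x *\<^sub>C u"
  by (rule bounded_linear_compose[OF scaleC.bounded_linear_left])

lemma rank_one_apply [simp]: "blinfun_apply (rank_one u \<phi>) x = \<phi> x *\<^sub>C u"
  by (simp add: rank_one.rep_eq)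

lemma norm_rank_one: "norm (rank_one u \<phi>) \<le> norm \<phi> * norm u"
proof (rule norm_blinfun_bound)
  fix x
  show "norm (blinfun_apply (rank_one u \<phi>) x) \<le> norm \<phi> * norm u * norm x"
    using mult_right_mono[OF norm_blinfun[of \<phi> x], of "norm u"] by (simp add: norm_scaleC mult_ac)
qed simp

text \<open>Total boundedness survives uniform approximation, so compactness may be tested up to an error.\<close>
lemma compact_ops_approx:
  fixes T :: "'a :: complex_banach \<Rightarrow>\<^sub>L 'b :: complex_banach"
  assumes T: "T \<in> bounded_ops"
    and approx: "\<And>e. 0 < e \<Longrightarrow> \<exists>K. compact K \<and> (\<forall>x\<in>cball 0 1. \<exists>y\<in>K. dist (T x) y < e)"
  shows "T \<in> compact_ops"
  unfolding compact_ops_def mem_Collect_eq compact_eq_totally_bounded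
proof (intro conjI T allI impI)
  let ?S = "closure (blinfun_apply T ` cball 0 1)"
  show "complete ?S" by (simp add: complete_eq_closed)
  fix e :: real assume "0 < e"
  then obtain K where K: "compact K" "\<And>x. x \<in> cball 0 1 \<Longrightarrow> \<exists>y\<in>K. dist (T x) y < e / 3"
    using approx[of "e / 3"] by auto
  then obtain k where k: "finite k" "K \<subseteq> (\<Union>x\<in>k. ball x (e / 3))"
    using \<open>0 < e\<close> compact_eq_totally_bounded[of K] by (metis divide_pos_pos zero_less_numeral)
  have "z \<in> (\<Union>x\<in>k. ball x e)" if "z \<in> ?S" for z
  proof -
    from that \<open>0 < e\<close> obtain x where x: "x \<in> cball 0 1" "dist (T x) z < e / 3"
      unfolding closure_approachable by (metis (no_types, lifting) divide_pos_pos imageE zero_less_numeral)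
    from K(2)[OF x(1)] obtain y where y: "y \<in> K" "dist (T x) y < e / 3" by blast
    with k obtain w where w: "w \<in> k" "dist w y < e / 3" by auto
    have "dist w z < e"
      using x(2) y(2) w(2) dist_triangle[of w z y] dist_triangle[of y z "T x"]
      by (simp add: dist_commute)
    with w show ?thesis by auto
  qed
  with k(1) show "\<exists>k. finite k \<and> ?S \<subseteq> (\<Union>x\<in>k. ball x e)" by blast
qed

text \<open>The partial sums map the unit ball into a sum of finitely many compact discs \<open>z *\<^sub>C u\<^sub>n\<close> with
  \<open>norm z \<le> norm \<phi>\<^sub>n\<close>, and they converge in the operator norm.\<close>
lemma rank_one_series:
  fixes u :: "nat \<Rightarrow> 'b :: complex_banach" and \<phi> :: "nat \<Rightarrow> 'a :: complex_banach \<Rightarrow>\<^sub>L complex"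
  assumes ops: "\<And>n. \<phi> n \<in> bounded_ops" and sm: "summable (\<lambda>n. norm (\<phi> n) * norm (u n))"
  obtains T where "T \<in> compact_ops" and "\<And>x. (\<lambda>n. blinfun_apply (\<phi> n) x *\<^sub>C u n) sums blinfun_apply T x"
proof -
  define R where "R n = rank_one (u n) (\<phi> n)" for n
  define T where "T = suminf R"
  have "summable R"
    using sm by (rule summable_comparison_test') (simp add: R_def norm_rank_one)
  then have sumsT: "R sums T" unfolding T_def by (rule summable_sums)
  have app: "(\<lambda>n. blinfun_apply (\<phi> n) x *\<^sub>C u n) sums blinfun_apply T x" for x
    using bounded_linear.sums[OF blinfun.bounded_linear_left sumsT, of x] by (simp add: R_def)
  have "T \<in> compact_ops"
  proof (rule compact_ops_approx)
    have "blinfun_apply T (c *\<^sub>C x) = c *\<^sub>C blinfun_apply T x" for c x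
    proof (rule sums_unique2[OF app])
      show "(\<lambda>n. blinfun_apply (\<phi> n) (c *\<^sub>C x) *\<^sub>C u n) sums (c *\<^sub>C blinfun_apply T x)"
        using bounded_linear.sums[OF scaleC.bounded_linear_right app[of x], of c]
        by (simp add: bounded_ops_scaleC[OF ops] scaleC_complex_def scaleC_scaleC)
    qed
    then show "T \<in> bounded_ops" by (simp add: bounded_ops_def)
  next
    fix e :: real assume "0 < e"
    from sumsT have "(\<lambda>N. \<Sum>n<N. R n) \<longlonglongrightarrow> T" by (simp add: sums_def)
    from LIMSEQ_D[OF this \<open>0 < e\<close>] obtain N where N: "norm ((\<Sum>n<N. R n) - T) < e" by blast
    have comp: "\<exists>K. compact K \<and> (\<forall>x\<in>cball 0 1. (\<Sum>n<m. blinfun_apply (\<phi> n) x *\<^sub>C u n) \<in> K)" for m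
    proof (induction m)
      case 0
      show ?case by (intro exI[of _ "{0}"]) auto
    next
      case (Suc m)
      then obtain K where K: "compact K" "\<And>x. x \<in> cball 0 1 \<Longrightarrow> (\<Sum>n<m. blinfun_apply (\<phi> n) x *\<^sub>C u n) \<in> K"
        by blast
      have sum_mem: "a + b \<in> {x + y | x y. x \<in> X \<and> y \<in> Y}" if "a \<in> X" "b \<in> Y" for a b :: 'b and X Y
        using that by blast
      let ?L = "(\<lambda>z. z *\<^sub>C u m) ` cball 0 (norm (\<phi> m))"
      have "compact ?L"
        by (intro compact_continuous_image linear_continuous_on scaleC.bounded_linear_left) simp
      then have "compact {x + y | x y. x \<in> K \<and> y \<in> ?L}"
        using K(1) by (intro compact_sums)
      moreover have L: "blinfun_apply (\<phi> m) x *\<^sub>C u m \<in> ?L" if "x \<in> cball 0 1" for x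
      proof (rule imageI)
        have "norm (blinfun_apply (\<phi> m) x) \<le> norm (\<phi> m) * norm x" by (rule norm_blinfun)
        also have "\<dots> \<le> norm (\<phi> m) * 1" using that by (intro mult_left_mono) auto
        finally show "blinfun_apply (\<phi> m) x \<in> cball 0 (norm (\<phi> m))" by simp
      qed
      ultimately show ?case
      proof (intro exI conjI ballI)
        fix x :: 'a assume x: "x \<in> cball 0 1"
        show "(\<Sum>n<Suc m. blinfun_apply (\<phi> n) x *\<^sub>C u n) \<in> {x + y | x y. x \<in> K \<and> y \<in> ?L}"
          unfolding sum.lessThan_Suc by (rule sum_mem[OF K(2)[OF x] L[OF x]])
      qed
    qed
    obtain K where K: "compact K \<and> (\<forall>x\<in>cball 0 1. (\<Sum>n<N. blinfun_apply (\<phi> n) x *\<^sub>C u n) \<in> K)"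
      using comp[of N] by (rule exE)
    have "dist (blinfun_apply T x) (\<Sum>n<N. blinfun_apply (\<phi> n) x *\<^sub>C u n) < e" if "x \<in> cball 0 1" for x
    proof -
      have "dist (blinfun_apply T x) (\<Sum>n<N. blinfun_apply (\<phi> n) x *\<^sub>C u n)
          = norm (blinfun_apply ((\<Sum>n<N. R n) - T) x)"
        by (simp add: R_def dist_norm norm_minus_commute blinfun.diff_left blinfun.sum_left)
      also have "\<dots> \<le> norm ((\<Sum>n<N. R n) - T) * norm x" by (rule norm_blinfun)
      also have "\<dots> \<le> norm ((\<Sum>n<N. R n) - T) * 1" using that by (intro mult_left_mono) auto
      finally show ?thesis using N by simp
    qed
    note near = this
    show "\<exists>K. compact K \<and> (\<forall>x\<in>cball 0 1. \<exists>y\<in>K. dist (blinfun_apply T x) y < e)"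
    proof (intro exI conjI ballI)
      show "compact K" using K ..
      fix x :: 'a assume "x \<in> cball 0 1"
      with K near show "\<exists>y\<in>K. dist (blinfun_apply T x) y < e"
        by (intro bexI[of _ "\<Sum>n<N. blinfun_apply (\<phi> n) x *\<^sub>C u n"]) (auto simp del: mem_cball)
    qed
  qed
  then show ?thesis using app by (rule that)
qed

lemma rank_one_compact:
  assumes "\<phi> \<in> bounded_ops"
  shows "rank_one u \<phi> \<in> compact_ops"
proof -
  obtain T where T: "T \<in> compact_ops"
    and app: "\<And>x. (\<lambda>n. blinfun_apply \<phi> x *\<^sub>C (if n = (0::nat) then u else 0)) sums blinfun_apply T x"
    using rank_one_series[of "\<lambda>_. \<phi>" "\<lambda>n. if n = 0 then u else 0"] assms
    by (auto simp: if_distrib cong: if_cong)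
  have "(\<lambda>n. blinfun_apply \<phi> x *\<^sub>C (if n = (0::nat) then u else 0)) sums (blinfun_apply \<phi> x *\<^sub>C u)" for x
    using sums_single[of 0 "\<lambda>_. blinfun_apply \<phi> x *\<^sub>C u"] by (simp add: if_distrib cong: if_cong)
  from sums_unique2[OF this app] have "rank_one u \<phi> = T" by (intro blinfun_eqI) simp
  with T show ?thesis by simp
qed

lemma rank_one_wo_measurable:
  assumes "u \<in> weakly_measurable M" and "\<phi> \<in> bounded_ops"
  shows "(\<lambda>s. rank_one (u s) \<phi>) \<in> wo_measurable M compact_ops"
  using assms by (auto simp: wo_measurable_iff rank_one_compact weakly_measurable_cscale)

lemma rank_one_series_wo_measurable:
  fixes u :: "nat \<Rightarrow> 's \<Rightarrow> 'a :: complex_banach" and \<phi> :: "nat \<Rightarrow> 'a \<Rightarrow>\<^sub>L complex"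
  assumes ops: "\<And>n. \<phi> n \<in> bounded_ops" and u: "\<And>n. u n \<in> weakly_measurable M"
    and sm: "\<And>s. summable (\<lambda>n. norm (\<phi> n) * norm (u n s))"
  obtains T where "T \<in> wo_measurable M compact_ops"
    and "\<And>s x. (\<lambda>n. blinfun_apply (\<phi> n) x *\<^sub>C u n s) sums blinfun_apply (T s) x"
proof -
  have "\<exists>T \<in> compact_ops. \<forall>x. (\<lambda>n. blinfun_apply (\<phi> n) x *\<^sub>C u n s) sums blinfun_apply T x" for s
    using rank_one_series[OF ops sm[of s]] by blast
  then obtain T where T: "\<And>s. T s \<in> compact_ops"
    and app: "\<And>s x. (\<lambda>n. blinfun_apply (\<phi> n) x *\<^sub>C u n s) sums blinfun_apply (T s) x"
    by metis
  have "(\<lambda>s. blinfun_apply (T s) x) \<in> weakly_measurable M" for x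
  proof (rule weakly_measurable_LIMSEQ)
    show "(\<lambda>s. \<Sum>n<k. blinfun_apply (\<phi> n) x *\<^sub>C u n s) \<in> weakly_measurable M" for k
      by (induction k) (simp_all add: weakly_measurable_const weakly_measurable_add weakly_measurable_cscale u)
    show "(\<lambda>k. \<Sum>n<k. blinfun_apply (\<phi> n) x *\<^sub>C u n s) \<longlonglongrightarrow> blinfun_apply (T s) x" for s
      using app by (simp add: sums_def)
  qed
  with T have "T \<in> wo_measurable M compact_ops" by (auto simp: wo_measurable_iff)
  then show ?thesis using app by (rule that)
qed


section \<open>Maps on vector functions whose commutators act pointwise\<close>

text \<open>The hypotheses concern only \<open>W\<close> on functions: it is complex linear almost everywhere, and its
  commutator with each compact-valued function is given pointwise by operators \<open>D s\<close>, which may be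
  arbitrary bounded real-linear operators. Neither compatibility with multiplication by scalar
  functions nor continuity of any kind is assumed; both come out in the end.\<close>
locale pointwise_commutators = dense_sequence q
  for q :: "nat \<Rightarrow> 'a :: complex_banach" +
  fixes M :: "'s measure" and W :: "('s \<Rightarrow> 'a) \<Rightarrow> 's \<Rightarrow> 'a"
  assumes infinite_dim: "infinite_dim TYPE('a)"
    and meas: "u \<in> weakly_measurable M \<Longrightarrow> W u \<in> weakly_measurable M"
    and add: "u \<in> weakly_measurable M \<Longrightarrow> v \<in> weakly_measurable M
      \<Longrightarrow> AE s in M. W (\<lambda>s. u s + v s) s = W u s + W v s"
    and scale: "u \<in> weakly_measurable M \<Longrightarrow> AE s in M. W (\<lambda>s. c *\<^sub>C u s) s = c *\<^sub>C W u s"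
    and commutator: "T \<in> wo_measurable M compact_ops \<Longrightarrow> \<exists>D. \<forall>h \<in> weakly_measurable M.
      AE s in M. W (\<lambda>s. blinfun_apply (T s) (h s)) s
        = blinfun_apply (D s) (h s) + blinfun_apply (T s) (W h s)"
begin

text \<open>With \<open>h\<close> equal to \<open>0\<close> on the set and to \<open>x 0\<close> off it, \<open>u = T h\<close> for \<open>T s = rank_one (u s) (\<phi> 0)\<close>.
  Where \<open>u\<close> and \<open>h\<close> vanish, so do both terms \<open>D s (h s)\<close> and \<open>T s (W h s)\<close> of \<open>W (T h) s\<close>.\<close>
lemma vanishing_local:
  assumes u: "u \<in> weakly_measurable M" and P: "{s \<in> space M. P s} \<in> sets M"
    and 0: "\<And>s. P s \<Longrightarrow> u s = 0"
  shows "AE s in M. P s \<longrightarrow> W u s = 0"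
proof -
  obtain x :: "nat \<Rightarrow> 'a" and \<phi> :: "nat \<Rightarrow> 'a \<Rightarrow>\<^sub>L complex"
    where \<phi>: "\<And>n. \<phi> n \<in> bounded_ops"
      and bi: "\<And>m n. blinfun_apply (\<phi> m) (x n) = (if m = n then 1 else 0)"
    by (rule biorthogonal_sequence_exists[OF infinite_dim]) (rule that)
  define h where "h s = (if P s then 0 else 1 :: complex) *\<^sub>C x 0" for s
  have "(\<lambda>s. if P s then 0 else 1 :: complex) \<in> borel_measurable M"
    using P by (intro measurable_If) auto
  then have h: "h \<in> weakly_measurable M"
    unfolding h_def by (intro weakly_measurable_scaleC weakly_measurable_const)
  define T where "T s = rank_one (u s) (\<phi> 0)" for s
  have "T \<in> wo_measurable M compact_ops"
    unfolding T_def by (intro rank_one_wo_measurable u \<phi>)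
  from commutator[OF this] h obtain D where D:
    "AE s in M. W (\<lambda>s. blinfun_apply (T s) (h s)) s = blinfun_apply (D s) (h s) + blinfun_apply (T s) (W h s)"
    by blast
  have Th: "(\<lambda>s. blinfun_apply (T s) (h s)) = u"
    by (rule ext) (simp add: T_def h_def 0 bi scaleC_one)
  from D show ?thesis
    unfolding Th
  proof eventually_elim
    case (elim s)
    then show ?case by (auto simp: h_def T_def 0 blinfun.zero_right)
  qed
qed

lemma equality_local:
  assumes u: "u \<in> weakly_measurable M" and v: "v \<in> weakly_measurable M"
    and P: "{s \<in> space M. P s} \<in> sets M" and eq: "\<And>s. P s \<Longrightarrow> u s = v s"
  shows "AE s in M. P s \<longrightarrow> W u s = W v s"
proof -
  have d: "(\<lambda>s. u s - v s) \<in> weakly_measurable M"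
    by (rule weakly_measurable_diff[OF u v])
  have "AE s in M. P s \<longrightarrow> W (\<lambda>s. u s - v s) s = 0"
    by (rule vanishing_local[OF d P]) (simp add: eq)
  moreover have "AE s in M. W u s = W v s + W (\<lambda>s. u s - v s) s"
    using add[OF v d] by simp
  ultimately show ?thesis by eventually_elim simp
qed

text \<open>Locality on the countably many pieces on which \<open>i\<close> is constant.\<close>
lemma glue:
  fixes h :: "nat \<Rightarrow> 's \<Rightarrow> 'a"
  assumes i: "i \<in> measurable M (count_space UNIV)" and h: "\<And>n. h n \<in> weakly_measurable M"
  shows "AE s in M. W (\<lambda>s. h (i s) s) s = W (h (i s)) s"
proof -
  have "AE s in M. i s = n \<longrightarrow> W (\<lambda>s. h (i s) s) s = W (h n) s" for n
  proof (rule equality_local[OF weakly_measurable_glue[OF i h] h])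
    show "{s \<in> space M. i s = n} \<in> sets M"
      using measurable_sets[OF i, of "{n}"] by (simp add: vimage_def Int_def conj_commute)
  qed simp
  then have "AE s in M. \<forall>n. i s = n \<longrightarrow> W (\<lambda>s. h (i s) s) s = W (h n) s"
    unfolding AE_all_countable by blast
  then show ?thesis by eventually_elim simp
qed

text \<open>The gliding hump: the function \<open>k n\<close>
  picks at each point a member of the family on which \<open>W\<close> exceeds the \<open>n\<close>-th threshold, and a single
  compact-valued \<open>T\<close> sees all \<open>k n\<close> at once through the biorthogonal sequence.\<close>
theorem countable_family_bounded:
  fixes h :: "nat \<Rightarrow> 's \<Rightarrow> 'a"
  assumes h: "\<And>n. h n \<in> weakly_measurable M" and h1: "\<And>n s. norm (h n s) \<le> 1"
  shows "AE s in M. \<exists>K. \<forall>n. norm (W (h n) s) \<le> K"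
proof -
  obtain x :: "nat \<Rightarrow> 'a" and \<phi> :: "nat \<Rightarrow> 'a \<Rightarrow>\<^sub>L complex"
    where \<phi>: "\<And>n. \<phi> n \<in> bounded_ops"
      and bi: "\<And>m n. blinfun_apply (\<phi> m) (x n) = (if m = n then 1 else 0)"
    by (rule biorthogonal_sequence_exists[OF infinite_dim]) (rule that)
  \<comment> \<open>Small enough for the series defining \<open>T\<close> to converge in norm, dominated by \<open>\<Sum>n. 2\<^sup>-\<^sup>n\<close>.\<close>
  define \<alpha> where "\<alpha> n = (1 / 2) ^ n / (1 + norm (\<phi> n))" for n
  have \<alpha>: "0 < \<alpha> n" for n
    by (simp add: \<alpha>_def add_pos_nonneg)
  \<comment> \<open>The commutator relation at \<open>x n\<close> bounds \<open>\<alpha> n * norm (W (k n) s)\<close> by a constant times \<open>b n s\<close>, and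
    \<open>b\<close> does not involve the family. So the threshold to beat is known before \<open>k n\<close> is chosen.\<close>
  define b where "b n s = norm (x n) + norm (W (\<lambda>_. x n) s)" for n s
  have b: "0 < b n s" for n s
  proof -
    have "x n \<noteq> 0" using bi[of n n] by auto
    then show ?thesis by (simp add: b_def add_pos_nonneg)
  qed
  \<comment> \<open>If no index exceeds the threshold, then \<open>LEAST\<close> is an arbitrary value, but at such a point the
    family is bounded and the claim holds.\<close>
  define i where "i n s = (LEAST m. real n * b n s / \<alpha> n < norm (W (h m) s))" for n s
  have [measurable]: "(\<lambda>s. norm (W (h m) s)) \<in> borel_measurable M"
      "(\<lambda>s. norm (W (\<lambda>_. x m) s)) \<in> borel_measurable M" for m
    by (intro norm_measurable meas h weakly_measurable_const)+
  have i: "i n \<in> measurable M (count_space UNIV)" for n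
    unfolding i_def b_def by measurable
  define k where "k n s = h (i n s) s" for n s
  have k: "k n \<in> weakly_measurable M" for n
    unfolding k_def by (rule weakly_measurable_glue[OF i h])
  have sm: "summable (\<lambda>n. norm (\<phi> n) * norm (of_real (\<alpha> n) *\<^sub>C k n s))" for s
  proof (rule summable_comparison_test')
    show "summable (\<lambda>n. (1 / 2) ^ n :: real)" by (rule summable_geometric) simp
    fix n
    have "norm (\<phi> n) * (\<alpha> n * norm (k n s)) \<le> norm (\<phi> n) * (\<alpha> n * 1)"
      using \<alpha>[of n] h1 unfolding k_def by (intro mult_left_mono) auto
    also have "\<dots> \<le> (1 + norm (\<phi> n)) * \<alpha> n" using \<alpha>[of n] by (simp add: algebra_simps)
    also have "\<dots> = (1 / 2) ^ n"
      unfolding \<alpha>_def by (simp add: add_nonneg_eq_0_iff)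
    finally show "norm (norm (\<phi> n) * norm (of_real (\<alpha> n) *\<^sub>C k n s)) \<le> (1 / 2) ^ n"
      using \<alpha>[of n] by (simp add: norm_scaleC)
  qed
  obtain T where T: "T \<in> wo_measurable M compact_ops"
    and sums: "\<And>s y. (\<lambda>n. blinfun_apply (\<phi> n) y *\<^sub>C of_real (\<alpha> n) *\<^sub>C k n s) sums blinfun_apply (T s) y"
    by (rule rank_one_series_wo_measurable[of \<phi> "\<lambda>n s. of_real (\<alpha> n) *\<^sub>C k n s" M])
      (use \<phi> sm weakly_measurable_cscale[OF k] in auto)
  have Tx: "blinfun_apply (T s) (x n) = of_real (\<alpha> n) *\<^sub>C k n s" for n s
  proof (rule sums_unique2[OF sums])
    have "(\<lambda>m. blinfun_apply (\<phi> m) (x n) *\<^sub>C of_real (\<alpha> m) *\<^sub>C k m s)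
        = (\<lambda>m. if m = n then of_real (\<alpha> m) *\<^sub>C k m s else 0)"
      by (auto simp: bi scaleC_one)
    then show "(\<lambda>m. blinfun_apply (\<phi> m) (x n) *\<^sub>C of_real (\<alpha> m) *\<^sub>C k m s)
        sums (of_real (\<alpha> n) *\<^sub>C k n s)"
      using sums_single[of n "\<lambda>m. of_real (\<alpha> m) *\<^sub>C k m s"] by simp
  qed
  obtain D where D: "\<And>g. g \<in> weakly_measurable M \<Longrightarrow> AE s in M. W (\<lambda>s. blinfun_apply (T s) (g s)) s
        = blinfun_apply (D s) (g s) + blinfun_apply (T s) (W g s)"
    using commutator[OF T] by blast
  have "AE s in M. W (\<lambda>s. of_real (\<alpha> n) *\<^sub>C k n s) s
      = blinfun_apply (D s) (x n) + blinfun_apply (T s) (W (\<lambda>_. x n) s)" for n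
    using D[OF weakly_measurable_const, of "x n"] by (simp add: Tx)
  then have 1: "AE s in M. \<forall>n. W (\<lambda>s. of_real (\<alpha> n) *\<^sub>C k n s) s
      = blinfun_apply (D s) (x n) + blinfun_apply (T s) (W (\<lambda>_. x n) s)"
    by (simp add: AE_all_countable)
  have 2: "AE s in M. \<forall>n. W (\<lambda>s. of_real (\<alpha> n) *\<^sub>C k n s) s = of_real (\<alpha> n) *\<^sub>C W (k n) s"
    using scale[OF k] by (simp add: AE_all_countable)
  have "AE s in M. W (k n) s = W (h (i n s)) s" for n
    using glue[OF i h] by (simp add: k_def[abs_def])
  then have 3: "AE s in M. \<forall>n. W (k n) s = W (h (i n s)) s"
    by (simp add: AE_all_countable)
  from 1 2 3 show ?thesis
  proof eventually_elim
    case (elim s)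
    show ?case
    proof (rule ccontr)
      assume "\<not> ?case"
      then have unbounded: "\<exists>m. K < norm (W (h m) s)" for K by (meson not_le)
      define C where "C = norm (D s) + norm (T s)"
      have "real n < C" for n
      proof -
        have "real n * b n s / \<alpha> n < norm (W (k n) s)"
          using elim(3) LeastI_ex[OF unbounded] unfolding i_def by metis
        then have "real n * b n s < \<alpha> n * norm (W (k n) s)"
          using \<alpha>[of n] by (simp add: field_simps)
        also have "\<dots> = norm (of_real (\<alpha> n) *\<^sub>C W (k n) s)"
          using \<alpha>[of n] by (simp add: norm_scaleC)
        also have "\<dots> = norm (blinfun_apply (D s) (x n) + blinfun_apply (T s) (W (\<lambda>_. x n) s))"
          using elim by metis
        also have "\<dots> \<le> norm (D s) * norm (x n) + norm (T s) * norm (W (\<lambda>_. x n) s)"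
          by (intro norm_triangle_mono norm_blinfun)
        also have "\<dots> \<le> C * b n s"
          by (simp add: C_def b_def algebra_simps)
        finally show ?thesis using b[of n s] by simp
      qed
      moreover obtain n where "C < real n" using reals_Archimedean2 by blast
      ultimately show False by (meson less_asym)
    qed
  qed
qed

lemma bounded_on_constants:
  fixes y :: "'i :: countable \<Rightarrow> 'a"
  shows "AE s in M. \<exists>K. \<forall>i. norm (W (\<lambda>_. y i) s) \<le> K * norm (y i)"
proof -
  define z where "z i = complex_of_real (inverse (norm (y i))) *\<^sub>C y i" for i
  have "norm (z i) \<le> 1" for i
    by (cases "y i = 0") (simp_all add: z_def norm_scaleC norm_inverse)
  then have "AE s in M. \<exists>K. \<forall>n. norm (W (\<lambda>_. z (from_nat n)) s) \<le> K"
    by (intro countable_family_bounded weakly_measurable_const)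
  moreover have "AE s in M. \<forall>i. W (\<lambda>_. y i) s = of_real (norm (y i)) *\<^sub>C W (\<lambda>_. z i) s"
    unfolding AE_all_countable
  proof
    fix i
    have "of_real (norm (y i)) *\<^sub>C z i = y i"
      by (cases "y i = 0") (simp_all add: z_def scaleC_scaleC scaleC_one flip: of_real_mult)
    then show "AE s in M. W (\<lambda>_. y i) s = of_real (norm (y i)) *\<^sub>C W (\<lambda>_. z i) s"
      using scale[OF weakly_measurable_const, of "of_real (norm (y i))" "z i"] by simp
  qed
  ultimately show ?thesis
  proof eventually_elim
    case (elim s)
    then obtain K where K: "\<And>n. norm (W (\<lambda>_. z (from_nat n)) s) \<le> K" by blast
    have "norm (W (\<lambda>_. y i) s) \<le> K * norm (y i)" for i
    proof -
      have "norm (W (\<lambda>_. y i) s) = norm (y i) * norm (W (\<lambda>_. z i) s)"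
        using elim(2) by (simp add: norm_scaleC)
      also have "\<dots> \<le> norm (y i) * K"
        using K[of "to_nat i"] by (intro mult_left_mono) auto
      finally show ?thesis by (simp add: mult.commute)
    qed
    then show ?case by blast
  qed
qed

text \<open>Boundedness on all combinations \<open>q i + c m *\<^sub>C q j - q l\<close>, a countable family, is exactly the
  hypothesis of \<open>lipschitz_extension\<close> at almost every point.\<close>
lemma pointwise_operator_exists:
  "AE s in M. \<exists>T \<in> bounded_ops. \<forall>i. blinfun_apply T (q i) = W (\<lambda>_. q i) s"
proof -
  obtain c :: "nat \<Rightarrow> complex" where c: "dense_sequence c" "0 \<in> range c"
    by (rule dense_sequence_complex)
  define y where "y = (\<lambda>(i, j, l, m). q i + c m *\<^sub>C q j - q l)"
  have "AE s in M. W (\<lambda>_. y (i, j, l, m)) s = W (\<lambda>_. q i) s + c m *\<^sub>C W (\<lambda>_. q j) s - W (\<lambda>_. q l) s"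
    for i j l m
  proof -
    have "AE s in M. W (\<lambda>_. y (i, j, l, m) + q l) s = W (\<lambda>_. y (i, j, l, m)) s + W (\<lambda>_. q l) s"
      by (intro add weakly_measurable_const)
    moreover have "AE s in M. W (\<lambda>_. q i + c m *\<^sub>C q j) s = W (\<lambda>_. q i) s + W (\<lambda>_. c m *\<^sub>C q j) s"
      by (intro add weakly_measurable_const)
    moreover have "AE s in M. W (\<lambda>_. c m *\<^sub>C q j) s = c m *\<^sub>C W (\<lambda>_. q j) s"
      by (intro scale weakly_measurable_const)
    ultimately show ?thesis
    proof eventually_elim
      case (elim s)
      have "y (i, j, l, m) + q l = q i + c m *\<^sub>C q j" by (simp add: y_def)
      with elim show ?case by (simp add: algebra_simps)
    qed
  qed
  then have "AE s in M. \<forall>i j l m.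
      W (\<lambda>_. y (i, j, l, m)) s = W (\<lambda>_. q i) s + c m *\<^sub>C W (\<lambda>_. q j) s - W (\<lambda>_. q l) s"
    by (simp add: AE_all_countable)
  with bounded_on_constants[of y] show ?thesis
  proof eventually_elim
    case (elim s)
    then obtain K where K: "\<And>i. norm (W (\<lambda>_. y i) s) \<le> K * norm (y i)" by blast
    have "norm (W (\<lambda>_. q i) s + c m *\<^sub>C W (\<lambda>_. q j) s - W (\<lambda>_. q l) s) \<le> K * norm (q i + c m *\<^sub>C q j - q l)"
      for i j l m
      using K[of "(i, j, l, m)"] elim(2) by (simp add: y_def)
    from lipschitz_extension[OF c this] show ?case by blast
  qed
qed

text \<open>At constants from the dense sequence \<open>w\<close> agrees with \<open>W\<close> by construction, and by gluing also at
  functions with values in that sequence. For general \<open>u\<close> with approximants \<open>v k\<close> the remainder is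
  small because \<open>W\<close> is bounded along \<open>2 ^ k *\<^sub>C (u - v k)\<close>.\<close>
theorem pointwise_representation:
  obtains w where "w \<in> wo_measurable M bounded_ops"
    and "\<And>u. u \<in> weakly_measurable M \<Longrightarrow> AE s in M. W u s = blinfun_apply (w s) (u s)"
proof -
  obtain N where bad: "{s \<in> space M. \<not> (\<exists>T \<in> bounded_ops. \<forall>i. blinfun_apply T (q i) = W (\<lambda>_. q i) s)} \<subseteq> N"
    and N: "N \<in> null_sets M"
    using AE_E[OF pointwise_operator_exists] by (metis (no_types, lifting) null_setsI)
  \<comment> \<open>Setting \<open>w\<close> to zero on a measurable null set containing all exceptional points keeps it measurable.\<close>
  have "\<exists>T. T \<in> bounded_ops \<and> (s \<in> space M \<longrightarrow> (\<forall>i. blinfun_apply T (q i) = (if s \<in> N then 0 else W (\<lambda>_. q i) s)))" for s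
  proof (cases "s \<in> space M - N")
    case True
    with bad show ?thesis by auto
  next
    case False
    have "0 \<in> (bounded_ops :: ('a \<Rightarrow>\<^sub>L 'a) set)" by (simp add: bounded_ops_def)
    with False show ?thesis by (intro exI[of _ 0]) auto
  qed
  then obtain w where w: "\<And>s. w s \<in> bounded_ops"
    and wq: "\<And>s i. s \<in> space M \<Longrightarrow> blinfun_apply (w s) (q i) = (if s \<in> N then 0 else W (\<lambda>_. q i) s)"
    by metis
  have wm: "(\<lambda>s. blinfun_apply (w s) (q i)) \<in> weakly_measurable M" for i
  proof (rule weakly_measurableI)
    fix \<phi> :: "'a \<Rightarrow>\<^sub>L complex" assume "\<phi> \<in> bounded_ops"
    then have [measurable]: "(\<lambda>s. blinfun_apply \<phi> (W (\<lambda>_. q i) s)) \<in> borel_measurable M"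
      by (intro weakly_measurableD[OF meas[OF weakly_measurable_const]])
    have [measurable]: "N \<in> sets M" using N by auto
    have "(\<lambda>s. if s \<in> N then 0 else blinfun_apply \<phi> (W (\<lambda>_. q i) s)) \<in> borel_measurable M"
      by measurable
    then show "(\<lambda>s. blinfun_apply \<phi> (blinfun_apply (w s) (q i))) \<in> borel_measurable M"
      by (rule measurable_cong[THEN iffD1, rotated]) (simp add: wq blinfun.zero_right)
  qed
  have wo: "w \<in> wo_measurable M bounded_ops"
    unfolding wo_measurable_iff
  proof (intro conjI allI)
    fix x
    show "(\<lambda>s. blinfun_apply (w s) x) \<in> weakly_measurable M"
      by (rule weakly_measurable_LIMSEQ[OF wm blinfun.tendsto[OF tendsto_const nearest_tendsto]])
  qed (use w in auto)
  have agree: "AE s in M. \<forall>i. blinfun_apply (w s) (q i) = W (\<lambda>_. q i) s"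
    using AE_not_in[OF N] AE_space by eventually_elim (simp add: wq)
  have "AE s in M. W u s = blinfun_apply (w s) (u s)" if u: "u \<in> weakly_measurable M" for u
  proof -
    define v where "v k s = q (nearest k (u s))" for k s
    have v: "v k \<in> weakly_measurable M" for k
      unfolding v_def using weakly_measurable_glue[OF nearest_measurable[OF u], of "\<lambda>i _. q i"]
      by (simp add: weakly_measurable_const)
    define r where "r k s = u s - v k s" for k s
    have r: "r k \<in> weakly_measurable M" for k
      unfolding r_def[abs_def] by (rule weakly_measurable_diff[OF u v])
    have "norm ((2 ^ k) *\<^sub>C r k s) \<le> 1" for k s
    proof -
      have "norm ((2 ^ k) *\<^sub>C r k s) = 2 ^ k * norm (u s - q (nearest k (u s)))"
        unfolding norm_scaleC by (simp add: norm_power r_def v_def)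
      with norm_nearest[of "u s" k] show ?thesis
        by (simp add: power_one_over field_simps)
    qed
    then have "AE s in M. \<exists>K. \<forall>k. norm (W (\<lambda>s. (2 ^ k) *\<^sub>C r k s) s) \<le> K"
      by (intro countable_family_bounded weakly_measurable_cscale r)
    moreover have "AE s in M. \<forall>k. W (\<lambda>s. (2 ^ k) *\<^sub>C r k s) s = (2 ^ k) *\<^sub>C W (r k) s"
      using scale[OF r] by (simp add: AE_all_countable)
    moreover have "AE s in M. \<forall>k. W u s = W (v k) s + W (r k) s"
      unfolding AE_all_countable
    proof
      fix k
      have "(\<lambda>s. v k s + r k s) = u" by (rule ext) (simp add: r_def)
      with add[OF v[of k] r[of k]] show "AE s in M. W u s = W (v k) s + W (r k) s" by simp
    qed
    moreover have "AE s in M. \<forall>k. W (v k) s = W (\<lambda>_. v k s) s"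
      using glue[OF nearest_measurable[OF u], of "\<lambda>i _. q i"]
      by (simp add: AE_all_countable v_def[abs_def] weakly_measurable_const)
    ultimately show ?thesis using agree
    proof eventually_elim
      case (elim s)
      then obtain K where K: "\<And>k. norm (W (\<lambda>s. (2 ^ k) *\<^sub>C r k s) s) \<le> K" by blast
      have close: "norm (blinfun_apply (w s) (v k s) - W u s) \<le> (1 / 2) ^ k * K" for k
      proof -
        have "W (v k) s = blinfun_apply (w s) (v k s)"
          using elim by (simp add: v_def)
        moreover have "W u s = W (v k) s + W (r k) s" using elim(3) by (rule spec)
        ultimately have "norm (blinfun_apply (w s) (v k s) - W u s) = norm (W (r k) s)"
          by simp
        moreover have "2 ^ k * norm (W (r k) s) \<le> K"
          using K[of k] elim(2) by (simp add: norm_scaleC norm_power)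
        ultimately show ?thesis by (simp add: power_one_over field_simps)
      qed
      have "(\<lambda>k. norm (blinfun_apply (w s) (v k s) - W u s)) \<longlonglongrightarrow> 0"
      proof (rule tendsto_sandwich[OF _ _ tendsto_const])
        show "\<forall>\<^sub>F k in sequentially. norm (blinfun_apply (w s) (v k s) - W u s) \<le> (1 / 2) ^ k * K"
          by (intro always_eventually allI close)
        show "(\<lambda>k. (1 / 2) ^ k * K) \<longlonglongrightarrow> 0"
          by (intro tendsto_mult_left_zero LIMSEQ_power_zero) simp
      qed simp
      then have "(\<lambda>k. blinfun_apply (w s) (v k s)) \<longlonglongrightarrow> W u s"
        by (simp add: LIM_zero_iff tendsto_norm_zero_iff)
      moreover have "(\<lambda>k. blinfun_apply (w s) (v k s)) \<longlonglongrightarrow> blinfun_apply (w s) (u s)"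
        unfolding v_def by (intro blinfun.tendsto tendsto_const nearest_tendsto)
      ultimately show ?case by (rule LIMSEQ_unique)
    qed
  qed
  with wo show ?thesis by (rule that)
qed

end

section \<open>Computing in the algebra of equivalence classes\<close>

lemma compact_ops_subset: "compact_ops \<subseteq> bounded_ops"
  by (auto simp: compact_ops_def)

lemma wo_measurable_mono: "B \<subseteq> B' \<Longrightarrow> f \<in> wo_measurable M B \<Longrightarrow> f \<in> wo_measurable M B'"
  by (auto simp: wo_measurable_def)

lemma wo_measurable_add:
  assumes "f \<in> wo_measurable M bounded_ops" "g \<in> wo_measurable M bounded_ops"
  shows "(\<lambda>s. f s + g s) \<in> wo_measurable M bounded_ops"
  using assms
  by (auto simp: wo_measurable_iff blinfun.add_left weakly_measurable_add bounded_ops_def scaleC_add_right Pi_iff)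

lemma wo_measurable_scaleC:
  assumes "f \<in> wo_measurable M bounded_ops"
  shows "(\<lambda>s. blinfun_scaleC c (f s)) \<in> wo_measurable M bounded_ops"
  using assms
  by (auto simp: wo_measurable_iff blinfun_scaleC.rep_eq weakly_measurable_cscale bounded_ops_def
      scaleC_scaleC Pi_iff mult.commute)

lemma (in dense_sequence) wo_measurable_compose:
  assumes f: "f \<in> wo_measurable M bounded_ops" and g: "g \<in> wo_measurable M bounded_ops"
  shows "(\<lambda>s. f s o\<^sub>L (g s :: 'a \<Rightarrow>\<^sub>L 'a)) \<in> wo_measurable M bounded_ops"
proof -
  have "(\<lambda>s. blinfun_apply (f s) (blinfun_apply (g s) x)) \<in> weakly_measurable M" for x
    using g by (intro weakly_measurable_apply[OF f]) (simp add: wo_measurable_iff)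
  with assms show ?thesis by (auto simp: wo_measurable_iff bounded_ops_def Pi_iff)
qed

lemma wo_measurable_cong:
  assumes "\<And>s. s \<in> space M \<Longrightarrow> f s = g s" and "f \<in> wo_measurable M B"
  shows "g \<in> wo_measurable M B"
proof -
  have "(\<lambda>s. blinfun_apply \<phi> (blinfun_apply (f s) x)) \<in> borel_measurable M \<longleftrightarrow>
      (\<lambda>s. blinfun_apply \<phi> (blinfun_apply (g s) x)) \<in> borel_measurable M" for x and \<phi> :: "'b \<Rightarrow>\<^sub>L complex"
    using assms(1) by (intro measurable_cong) simp
  with assms show ?thesis by (simp add: wo_measurable_def Pi_iff)
qed

lemma ae_class_self: "f \<in> wo_measurable M bounded_ops \<Longrightarrow> f \<in> ae_class M f"
  by (simp add: ae_class_def)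

text \<open>The operations on classes are unions over representatives, so they compute as expected only because
  a class of a measurable function is nonempty.\<close>
lemma ae_class_nonempty: "f \<in> wo_measurable M bounded_ops \<Longrightarrow> ae_class M f \<noteq> {}"
  using ae_class_self by blast

lemma ae_class_cong:
  assumes "AE s in M. f s = g s"
  shows "ae_class M f = ae_class M g"
proof -
  have "(AE s in M. h s = f s) \<longleftrightarrow> (AE s in M. h s = g s)" for h
  proof
    assume "AE s in M. h s = f s"
    with assms show "AE s in M. h s = g s" by eventually_elim simp
  next
    assume "AE s in M. h s = g s"
    with assms show "AE s in M. h s = f s" by eventually_elim simp
  qed
  then show ?thesis by (simp add: ae_class_def)
qed

lemma ae_class_eqD:
  assumes "ae_class M f = ae_class M g" and "f \<in> wo_measurable M bounded_ops"
  shows "AE s in M. f s = g s"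
  using ae_class_self[OF assms(2)] unfolding assms(1) by (simp add: ae_class_def)

lemma ae_class_AE: "f' \<in> ae_class M f \<Longrightarrow> AE s in M. f' s = f s"
  by (simp add: ae_class_def)

lemma L0_wo_carrierE:
  assumes "F \<in> carrier (L0_wo M B)"
  obtains f where "f \<in> wo_measurable M B" and "F = ae_class M f"
  using assms by (auto simp: L0_wo_def)

lemma L0_wo_carrierI: "f \<in> wo_measurable M B \<Longrightarrow> ae_class M f \<in> carrier (L0_wo M B)"
  by (simp add: L0_wo_def)

context
  fixes f g :: "'s \<Rightarrow> 'a :: complex_banach \<Rightarrow>\<^sub>L 'a" and M :: "'s measure"
  assumes f: "f \<in> wo_measurable M bounded_ops" and g: "g \<in> wo_measurable M bounded_ops"
begin

lemma L0_wo_mult: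
  "ae_class M f \<otimes>\<^bsub>L0_wo M B\<^esub> ae_class M g = ae_class M (\<lambda>s. f s o\<^sub>L g s)"
proof -
  have "ae_class M (\<lambda>s. f' s o\<^sub>L g' s) = ae_class M (\<lambda>s. f s o\<^sub>L g s)"
    if "f' \<in> ae_class M f" "g' \<in> ae_class M g" for f' g'
  proof (rule ae_class_cong)
    show "AE s in M. f' s o\<^sub>L g' s = f s o\<^sub>L g s"
      using ae_class_AE[OF that(1)] ae_class_AE[OF that(2)] by eventually_elim simp
  qed
  then show ?thesis
    by (simp add: L0_wo_def ae_class_nonempty[OF f] ae_class_nonempty[OF g])
qed

lemma L0_wo_add:
  "ae_class M f \<oplus>\<^bsub>L0_wo M B\<^esub> ae_class M g = ae_class M (\<lambda>s. f s + g s)"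
proof -
  have "ae_class M (\<lambda>s. f' s + g' s) = ae_class M (\<lambda>s. f s + g s)"
    if "f' \<in> ae_class M f" "g' \<in> ae_class M g" for f' g'
  proof (rule ae_class_cong)
    show "AE s in M. f' s + g' s = f s + g s"
      using ae_class_AE[OF that(1)] ae_class_AE[OF that(2)] by eventually_elim simp
  qed
  then show ?thesis
    by (simp add: L0_wo_def ae_class_nonempty[OF f] ae_class_nonempty[OF g])
qed

lemma L0_wo_smult:
  "c \<odot>\<^bsub>L0_wo M B\<^esub> ae_class M f = ae_class M (\<lambda>s. blinfun_scaleC c (f s))"
proof -
  have "ae_class M (\<lambda>s. blinfun_scaleC c (f' s)) = ae_class M (\<lambda>s. blinfun_scaleC c (f s))"
    if "f' \<in> ae_class M f" for f'
  proof (rule ae_class_cong)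
    show "AE s in M. blinfun_scaleC c (f' s) = blinfun_scaleC c (f s)"
      using ae_class_AE[OF that] by eventually_elim simp
  qed
  then show ?thesis
    by (simp add: L0_wo_def ae_class_nonempty[OF f])
qed

end

lemma blinfun_scaleC_minus_one: "blinfun_scaleC (- 1) T = - T"
  by (rule blinfun_eqI) (simp add: blinfun_scaleC.rep_eq blinfun.minus_left scaleC_one)

text \<open>Subtraction is defined through a unique choice of the additive inverse, so uniqueness of inverses
  modulo null sets has to be checked along with existence.\<close>
lemma L0_wo_minus:
  assumes f: "f \<in> wo_measurable M bounded_ops" and g: "g \<in> wo_measurable M bounded_ops"
  shows "ae_class M f \<ominus>\<^bsub>L0_wo M bounded_ops\<^esub> ae_class M g = ae_class M (\<lambda>s. f s - g s)"
proof -
  let ?R = "L0_wo M bounded_ops"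
  have mg: "(\<lambda>s. - g s) \<in> wo_measurable M bounded_ops"
    using wo_measurable_scaleC[OF g, of "- 1"] by (simp add: blinfun_scaleC_minus_one)
  have zero: "\<zero>\<^bsub>?R\<^esub> = ae_class M (\<lambda>s. 0)"
    by (simp add: L0_wo_def)
  have "\<ominus>\<^bsub>?R\<^esub> ae_class M g = ae_class M (\<lambda>s. - g s)"
    unfolding a_inv_def m_inv_def
  proof (rule the_equality)
    show "ae_class M (\<lambda>s. - g s) \<in> carrier (add_monoid ?R) \<and>
        ae_class M g \<otimes>\<^bsub>add_monoid ?R\<^esub> ae_class M (\<lambda>s. - g s) = \<one>\<^bsub>add_monoid ?R\<^esub> \<and>
        ae_class M (\<lambda>s. - g s) \<otimes>\<^bsub>add_monoid ?R\<^esub> ae_class M g = \<one>\<^bsub>add_monoid ?R\<^esub>"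
      using L0_wo_carrierI[OF mg] by (simp add: L0_wo_add[OF g mg] L0_wo_add[OF mg g] zero)
  next
    fix Y assume Y: "Y \<in> carrier (add_monoid ?R) \<and> ae_class M g \<otimes>\<^bsub>add_monoid ?R\<^esub> Y = \<one>\<^bsub>add_monoid ?R\<^esub> \<and>
        Y \<otimes>\<^bsub>add_monoid ?R\<^esub> ae_class M g = \<one>\<^bsub>add_monoid ?R\<^esub>"
    then obtain y where y: "y \<in> wo_measurable M bounded_ops" "Y = ae_class M y"
      by (auto elim: L0_wo_carrierE)
    with Y have "ae_class M (\<lambda>s. y s + g s) = ae_class M (\<lambda>s. 0)"
      by (simp add: L0_wo_add[OF y(1) g] zero)
    then have "AE s in M. y s + g s = 0"
      by (rule ae_class_eqD) (rule wo_measurable_add[OF y(1) g])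
    then have "AE s in M. y s = - g s"
      by eventually_elim (simp add: eq_neg_iff_add_eq_0)
    then show "Y = ae_class M (\<lambda>s. - g s)"
      unfolding y(2) by (rule ae_class_cong)
  qed
  then show ?thesis
    by (simp add: a_minus_def L0_wo_add[OF f mg])
qed

section \<open>Derivations\<close>

text \<open>The values of the functions lie in any set \<open>B\<close> between the compact and the bounded operators. No
  closure property of \<open>B\<close> is assumed; in the rules below the sums and products in question are
  required to be \<open>B\<close>-valued instead.\<close>
locale L0_wo_derivation = dense_sequence q
  for q :: "nat \<Rightarrow> 'a :: complex_banach" +
  fixes M :: "'s measure" and B :: "('a \<Rightarrow>\<^sub>L 'a) set"
    and \<delta> :: "('s \<Rightarrow> 'a \<Rightarrow>\<^sub>L 'a) set \<Rightarrow> ('s \<Rightarrow> 'a \<Rightarrow>\<^sub>L 'a) set"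
  assumes compact: "compact_ops \<subseteq> B" and bounded: "B \<subseteq> bounded_ops"
    and derivation: "derivation (L0_wo M B) \<delta>"
begin

text \<open>A choice of representatives turns \<open>\<delta>\<close> into a map on functions. It satisfies the rules of a
  derivation almost everywhere, with an exceptional set depending on the functions involved.\<close>
definition lift :: "('s \<Rightarrow> 'a \<Rightarrow>\<^sub>L 'a) \<Rightarrow> 's \<Rightarrow> 'a \<Rightarrow>\<^sub>L 'a" where
  "lift f = (SOME g. g \<in> wo_measurable M B \<and> \<delta> (ae_class M f) = ae_class M g)"

lemma lift:
  assumes "f \<in> wo_measurable M B"
  shows "lift f \<in> wo_measurable M bounded_ops" and "\<delta> (ae_class M f) = ae_class M (lift f)"
proof -
  have "\<delta> (ae_class M f) \<in> carrier (L0_wo M B)"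
    using derivation L0_wo_carrierI[OF assms] by (auto simp: derivation_def)
  then obtain g where "g \<in> wo_measurable M B" "\<delta> (ae_class M f) = ae_class M g"
    by (rule L0_wo_carrierE)
  then have *: "\<exists>g. g \<in> wo_measurable M B \<and> \<delta> (ae_class M f) = ae_class M g" by blast
  have "lift f \<in> wo_measurable M B \<and> \<delta> (ae_class M f) = ae_class M (lift f)"
    using someI_ex[OF *] unfolding lift_def[symmetric] .
  then show "lift f \<in> wo_measurable M bounded_ops" "\<delta> (ae_class M f) = ae_class M (lift f)"
    using wo_measurable_mono[OF bounded] by auto
qed

lemma wo_measurable_B_bounded: "f \<in> wo_measurable M B \<Longrightarrow> f \<in> wo_measurable M bounded_ops"
  by (rule wo_measurable_mono[OF bounded])

lemma lift_cong:
  assumes "f \<in> wo_measurable M B" "g \<in> wo_measurable M B" and "AE s in M. f s = g s"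
  shows "AE s in M. lift f s = lift g s"
  using lift(2)[OF assms(1)] lift(2)[OF assms(2)] ae_class_cong[OF assms(3)]
  by (intro ae_class_eqD lift(1) assms) simp

lemma lift_add:
  assumes f: "f \<in> wo_measurable M B" and g: "g \<in> wo_measurable M B"
    and fg: "(\<lambda>s. f s + g s) \<in> wo_measurable M B"
  shows "AE s in M. lift (\<lambda>s. f s + g s) s = lift f s + lift g s"
proof (rule ae_class_eqD[OF _ lift(1)[OF fg]])
  have "ae_class M (lift (\<lambda>s. f s + g s)) = \<delta> (ae_class M f \<oplus>\<^bsub>L0_wo M B\<^esub> ae_class M g)"
    by (simp add: L0_wo_add[OF wo_measurable_B_bounded[OF f] wo_measurable_B_bounded[OF g]] lift(2)[OF fg])
  also have "\<dots> = \<delta> (ae_class M f) \<oplus>\<^bsub>L0_wo M B\<^esub> \<delta> (ae_class M g)"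
    using derivation L0_wo_carrierI[OF f] L0_wo_carrierI[OF g] by (simp add: derivation_def)
  finally show "ae_class M (lift (\<lambda>s. f s + g s)) = ae_class M (\<lambda>s. lift f s + lift g s)"
    by (simp add: lift(2)[OF f] lift(2)[OF g] L0_wo_add[OF lift(1)[OF f] lift(1)[OF g]])
qed

lemma lift_scaleC:
  assumes f: "f \<in> wo_measurable M B" and cf: "(\<lambda>s. blinfun_scaleC c (f s)) \<in> wo_measurable M B"
  shows "AE s in M. lift (\<lambda>s. blinfun_scaleC c (f s)) s = blinfun_scaleC c (lift f s)"
proof (rule ae_class_eqD[OF _ lift(1)[OF cf]])
  have "ae_class M (lift (\<lambda>s. blinfun_scaleC c (f s))) = \<delta> (c \<odot>\<^bsub>L0_wo M B\<^esub> ae_class M f)"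
    by (simp add: L0_wo_smult[OF wo_measurable_B_bounded[OF f] wo_measurable_B_bounded[OF f]] lift(2)[OF cf])
  also have "\<dots> = c \<odot>\<^bsub>L0_wo M B\<^esub> \<delta> (ae_class M f)"
    using derivation L0_wo_carrierI[OF f] by (simp add: derivation_def)
  finally show "ae_class M (lift (\<lambda>s. blinfun_scaleC c (f s))) = ae_class M (\<lambda>s. blinfun_scaleC c (lift f s))"
    by (simp add: lift(2)[OF f] L0_wo_smult[OF lift(1)[OF f] lift(1)[OF f]])
qed

lemma lift_compose:
  assumes f: "f \<in> wo_measurable M B" and g: "g \<in> wo_measurable M B"
    and fg: "(\<lambda>s. f s o\<^sub>L g s) \<in> wo_measurable M B"
  shows "AE s in M. lift (\<lambda>s. f s o\<^sub>L g s) s = (lift f s o\<^sub>L g s) + (f s o\<^sub>L lift g s)"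
proof (rule ae_class_eqD[OF _ lift(1)[OF fg]])
  have "ae_class M (lift (\<lambda>s. f s o\<^sub>L g s)) = \<delta> (ae_class M f \<otimes>\<^bsub>L0_wo M B\<^esub> ae_class M g)"
    by (simp add: L0_wo_mult[OF wo_measurable_B_bounded[OF f] wo_measurable_B_bounded[OF g]] lift(2)[OF fg])
  also have "\<dots> = (\<delta> (ae_class M f) \<otimes>\<^bsub>L0_wo M B\<^esub> ae_class M g)
      \<oplus>\<^bsub>L0_wo M B\<^esub> (ae_class M f \<otimes>\<^bsub>L0_wo M B\<^esub> \<delta> (ae_class M g))"
    using derivation L0_wo_carrierI[OF f] L0_wo_carrierI[OF g] by (simp add: derivation_def)
  also have "\<dots> = ae_class M (\<lambda>s. (lift f s o\<^sub>L g s) + (f s o\<^sub>L lift g s))"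
    by (simp add: lift(2)[OF f] lift(2)[OF g] L0_wo_mult[OF lift(1)[OF f] wo_measurable_B_bounded[OF g]]
        L0_wo_mult[OF wo_measurable_B_bounded[OF f] lift(1)[OF g]]
        L0_wo_add[OF wo_measurable_compose[OF lift(1)[OF f] wo_measurable_B_bounded[OF g]]
          wo_measurable_compose[OF wo_measurable_B_bounded[OF f] lift(1)[OF g]]])
  finally show "ae_class M (lift (\<lambda>s. f s o\<^sub>L g s)) = ae_class M (\<lambda>s. (lift f s o\<^sub>L g s) + (f s o\<^sub>L lift g s))" .
qed

text \<open>The map \<open>W u = lift (u \<otimes> \<phi>\<^sub>0) x\<^sub>0\<close> has pointwise commutators by the product rule, so it is given by
  a pointwise operator \<open>w\<close>. Reading the product rule at each vector of the dense sequence then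
  identifies \<open>lift f\<close> with the commutator of \<open>w\<close> and \<open>f\<close>.\<close>
theorem derivation_is_commutator:
  assumes inf: "infinite_dim TYPE('a)"
  obtains w where "w \<in> wo_measurable M bounded_ops"
    and "\<And>f. f \<in> wo_measurable M B \<Longrightarrow> AE s in M. lift f s = (w s o\<^sub>L f s) - (f s o\<^sub>L w s)"
proof -
  obtain x :: "nat \<Rightarrow> 'a" and \<phi> :: "nat \<Rightarrow> 'a \<Rightarrow>\<^sub>L complex"
    where ops: "\<And>n. \<phi> n \<in> bounded_ops"
      and bi: "\<And>m n. blinfun_apply (\<phi> m) (x n) = (if m = n then 1 else 0)"
    by (rule biorthogonal_sequence_exists[OF inf]) (rule that)
  define \<rho> where "\<rho> u s = rank_one (u s) (\<phi> 0)" for u :: "'s \<Rightarrow> 'a" and s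
  define W where "W u s = blinfun_apply (lift (\<rho> u) s) (x 0)" for u s
  have \<rho>: "\<rho> u \<in> wo_measurable M B" if "u \<in> weakly_measurable M" for u
    unfolding \<rho>_def[abs_def]
    by (rule wo_measurable_mono[OF compact rank_one_wo_measurable[OF that ops]])
  have leibniz: "AE s in M. W (\<lambda>s. blinfun_apply (f s) (h s)) s
      = blinfun_apply (lift f s) (h s) + blinfun_apply (f s) (W h s)"
    if f: "f \<in> wo_measurable M B" and h: "h \<in> weakly_measurable M" for f h
  proof -
    let ?fh = "\<lambda>s. blinfun_apply (f s) (h s)"
    have fh: "?fh \<in> weakly_measurable M" by (rule weakly_measurable_apply[OF f h])
    \<comment> \<open>This uses complex linearity of \<open>f s\<close>, hence holds on the space of the measure only.\<close>
    have eq: "\<rho> ?fh s = f s o\<^sub>L \<rho> h s" if "s \<in> space M" for s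
    proof (rule blinfun_eqI)
      have "f s \<in> bounded_ops"
        using f bounded that by (auto simp: wo_measurable_iff)
      then show "blinfun_apply (\<rho> ?fh s) y = blinfun_apply (f s o\<^sub>L \<rho> h s) y" for y
        by (simp add: \<rho>_def bounded_ops_scaleC)
    qed
    have comp: "(\<lambda>s. f s o\<^sub>L \<rho> h s) \<in> wo_measurable M B"
      by (rule wo_measurable_cong[OF eq \<rho>[OF fh]])
    have "AE s in M. \<rho> ?fh s = f s o\<^sub>L \<rho> h s"
      using eq by (rule AE_I2)
    from lift_cong[OF \<rho>[OF fh] comp this] lift_compose[OF f \<rho>[OF h] comp] show ?thesis
      by eventually_elim (simp add: W_def blinfun.add_left, simp add: \<rho>_def bi scaleC_one)
  qed
  interpret pointwise_commutators q M W
  proof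
    show "W u \<in> weakly_measurable M" if "u \<in> weakly_measurable M" for u
      using lift(1)[OF \<rho>[OF that]] by (simp add: W_def[abs_def] wo_measurable_iff)
    show "AE s in M. W (\<lambda>s. u s + v s) s = W u s + W v s"
      if "u \<in> weakly_measurable M" "v \<in> weakly_measurable M" for u v
    proof -
      have "\<rho> (\<lambda>s. u s + v s) = (\<lambda>s. \<rho> u s + \<rho> v s)"
        by (intro ext blinfun_eqI) (simp add: \<rho>_def blinfun.add_left scaleC_add_right)
      with lift_add[OF \<rho>[OF that(1)] \<rho>[OF that(2)]] \<rho>[OF weakly_measurable_add[OF that]]
      have "AE s in M. lift (\<rho> (\<lambda>s. u s + v s)) s = lift (\<rho> u) s + lift (\<rho> v) s" by simp
      then show ?thesis by eventually_elim (simp add: W_def blinfun.add_left)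
    qed
    show "AE s in M. W (\<lambda>s. c *\<^sub>C u s) s = c *\<^sub>C W u s" if "u \<in> weakly_measurable M" for u c
    proof -
      have "\<rho> (\<lambda>s. c *\<^sub>C u s) = (\<lambda>s. blinfun_scaleC c (\<rho> u s))"
        by (intro ext blinfun_eqI) (simp add: \<rho>_def blinfun_scaleC.rep_eq scaleC_scaleC mult.commute)
      with lift_scaleC[OF \<rho>[OF that(1)], of c] \<rho>[OF weakly_measurable_cscale[OF that], of c]
      have "AE s in M. lift (\<rho> (\<lambda>s. c *\<^sub>C u s)) s = blinfun_scaleC c (lift (\<rho> u) s)" by simp
      then show ?thesis by eventually_elim (simp add: W_def blinfun_scaleC.rep_eq)
    qed
    show "\<exists>D. \<forall>h \<in> weakly_measurable M. AE s in M. W (\<lambda>s. blinfun_apply (T s) (h s)) s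
        = blinfun_apply (D s) (h s) + blinfun_apply (T s) (W h s)"
      if "T \<in> wo_measurable M compact_ops" for T
      using leibniz[OF wo_measurable_mono[OF compact that]] by blast
  qed (rule inf)
  obtain w where w: "w \<in> wo_measurable M bounded_ops"
    and W: "\<And>u. u \<in> weakly_measurable M \<Longrightarrow> AE s in M. W u s = blinfun_apply (w s) (u s)"
    by (rule pointwise_representation) (rule that)
  have "AE s in M. lift f s = (w s o\<^sub>L f s) - (f s o\<^sub>L w s)" if f: "f \<in> wo_measurable M B" for f
  proof -
    have "AE s in M. \<forall>i. blinfun_apply (lift f s) (q i) = blinfun_apply ((w s o\<^sub>L f s) - (f s o\<^sub>L w s)) (q i)"
      unfolding AE_all_countable
    proof
      fix i
      have "(\<lambda>s. blinfun_apply (f s) (q i)) \<in> weakly_measurable M"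
        using f by (simp add: wo_measurable_iff)
      from leibniz[OF f weakly_measurable_const, of "q i"] W[OF this] W[OF weakly_measurable_const, of "q i"]
      show "AE s in M. blinfun_apply (lift f s) (q i) = blinfun_apply ((w s o\<^sub>L f s) - (f s o\<^sub>L w s)) (q i)"
        by eventually_elim (simp add: blinfun.diff_left algebra_simps)
    qed
    then show ?thesis
      by eventually_elim (blast intro: bounded_operator_eqI)
  qed
  with w show ?thesis by (rule that)
qed

end

theorem corollary5p16:
  fixes M :: "'s measure"
    and A :: "(complex, ('s \<Rightarrow> 'a :: complex_banach \<Rightarrow>\<^sub>L 'a) set) module"
    and \<delta> :: "('s \<Rightarrow> 'a \<Rightarrow>\<^sub>L 'a) set \<Rightarrow> ('s \<Rightarrow> 'a \<Rightarrow>\<^sub>L 'a) set"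
  assumes "complete_measure M" and "sigma_finite_measure M"
    and "infinite_dim TYPE('a)" and "separable_space (euclidean :: 'a topology)"
    and "A = L0_wo M bounded_ops \<or> A = L0_wo M compact_ops"
    and "derivation A \<delta>"
  shows "\<exists>w \<in> carrier (L0_wo M bounded_ops). \<forall>f \<in> carrier A.
           \<delta> f = (w \<otimes>\<^bsub>L0_wo M bounded_ops\<^esub> f) \<ominus>\<^bsub>L0_wo M bounded_ops\<^esub> (f \<otimes>\<^bsub>L0_wo M bounded_ops\<^esub> w)"
proof -
  obtain B where A: "A = L0_wo M B" and B: "compact_ops \<subseteq> B" "B \<subseteq> bounded_ops"
    using assms(5) compact_ops_subset by blast
  obtain q :: "nat \<Rightarrow> 'a" where "dense_sequence q"
    using assms(4) by (rule separable_imp_dense_sequence)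
  then interpret dense_sequence q .
  interpret L0_wo_derivation q M B \<delta>
    by standard (use B assms(6) in \<open>simp_all add: A\<close>)
  obtain w where w: "w \<in> wo_measurable M bounded_ops"
    and lift_eq: "\<And>f. f \<in> wo_measurable M B \<Longrightarrow> AE s in M. lift f s = (w s o\<^sub>L f s) - (f s o\<^sub>L w s)"
    using derivation_is_commutator[OF assms(3)] by blast
  show ?thesis
  proof (intro bexI[of _ "ae_class M w"] ballI)
    show "ae_class M w \<in> carrier (L0_wo M bounded_ops)" by (rule L0_wo_carrierI[OF w])
    fix F assume "F \<in> carrier A"
    then obtain f where f: "f \<in> wo_measurable M B" and F: "F = ae_class M f"
      unfolding A by (rule L0_wo_carrierE)
    note f' = wo_measurable_B_bounded[OF f]
    have "\<delta> F = ae_class M (\<lambda>s. (w s o\<^sub>L f s) - (f s o\<^sub>L w s))"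
      unfolding F lift(2)[OF f] by (rule ae_class_cong[OF lift_eq[OF f]])
    then show "\<delta> F = (ae_class M w \<otimes>\<^bsub>L0_wo M bounded_ops\<^esub> F)
        \<ominus>\<^bsub>L0_wo M bounded_ops\<^esub> (F \<otimes>\<^bsub>L0_wo M bounded_ops\<^esub> ae_class M w)"
      unfolding F L0_wo_mult[OF w f'] L0_wo_mult[OF f' w]
      by (simp add: L0_wo_minus[OF wo_measurable_compose[OF w f'] wo_measurable_compose[OF f' w]])
  qed
qed

end
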